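(* For every $\epsilon > 0$ there exists a constant $C_\epsilon > 0$ (depending only on $\epsilon$) and a constant $D > 0$ such that for every $n$-vertex graph $G = (V, E)$, there exists a $+k$ additive emulator $H = (V, E', w)$ of $G$ with $|E'| \le C_\epsilon n$ and $k \le D\, n^{\frac{1}{3+\sqrt{5}} + \epsilon}$.
   Context: Graphs $G$ are undirected and unweighted; $\texttt{dist}_G(s,t)$ denotes the shortest-path distance in $G$. For a graph $G=(V,E)$, a weighted graph $H = (V, E', w)$ on the same vertex set (with arbitrary edge set $E'$ and nonnegative edge weights $w$) is a $+k$ additive emulator of $G$ if for all vertices $s,t \in V$, $\texttt{dist}_G(s,t) \le \texttt{dist}_H(s,t) \le \texttt{dist}_G(s,t) + k$, where $\texttt{dist}_H$ is the weighted shortest-path distance in $H$. The size of the emulator is its number of edges $|E'|$. *)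

theory Defs
  imports Complex_Main "Graph_Theory.Pair_Digraph" "Graph_Theory.Shortest_Path"
begin

text \<open>
  A finite simple undirected graph is a \<^locale>\<open>pair_graph\<close>: a finite loop-free symmetric
  digraph whose arcs are ordered pairs of vertices. Each undirected edge is represented by
  two opposite arcs, so edges must be counted as unordered pairs.
\<close>

definition undirected_edges :: "'a pair_pre_digraph \<Rightarrow> 'a set set" where
  "undirected_edges G = (\<lambda>(u, v). {u, v}) ` parcs G"

definition edge_weighting :: "'a pair_pre_digraph \<Rightarrow> ('a \<times> 'a \<Rightarrow> real) \<Rightarrow> bool" where
  "edge_weighting G w \<longleftrightarrow> (\<forall>(u, v) \<in> parcs G. 0 \<le> w (u, v) \<and> w (u, v) = w (v, u))"

text \<open>Distances are extended reals: \<open>\<infinity>\<close> between different components.\<close>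

definition weighted_dist ::
    "'a pair_pre_digraph \<Rightarrow> ('a \<times> 'a \<Rightarrow> real) \<Rightarrow> 'a \<Rightarrow> 'a \<Rightarrow> ereal" where
  "weighted_dist G w s t = wf_digraph.\<mu> (with_proj G) w s t"

definition graph_dist :: "'a pair_pre_digraph \<Rightarrow> 'a \<Rightarrow> 'a \<Rightarrow> ereal" where
  "graph_dist G = weighted_dist G (\<lambda>_. 1)"

definition additive_emulator ::
    "'a pair_pre_digraph \<Rightarrow> 'a pair_pre_digraph \<Rightarrow> ('a \<times> 'a \<Rightarrow> real) \<Rightarrow> real \<Rightarrow> bool" where
  "additive_emulator G H w k \<longleftrightarrow>
     pair_graph H \<and> pverts H = pverts G \<and> edge_weighting H w \<and>
     (\<forall>s \<in> pverts G. \<forall>t \<in> pverts G.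
        graph_dist G s t \<le> weighted_dist H w s t \<and>
        weighted_dist H w s t \<le> graph_dist G s t + ereal k)"

end

theory Submission
  imports Defs
begin

text \<open>
  Suppose every graph on \<open>m\<close> vertices has a linear-size emulator with error \<open>O(m\<^sup>\<beta>)\<close>. Put
  \<open>\<alpha> = 1 / (6 - 4\<beta>)\<close> and \<open>R = n\<^sup>\<alpha>\<close>, and cover the graph by clusters of radius about \<open>R\<close>, of linear
  total size, each equipped with a thin sphere around its core. A shortest path hops from a sphere
  vertex to the thin sphere of the cluster owning that vertex. For clusters with at most \<open>R\<^sup>2\<close>
  vertices all these hops can be stored exactly with \<open>O(n)\<close> edges; inside a larger cluster \<open>c\<close> a
  recursive emulator makes the hop at error \<open>\<omega> c = O(|c|\<^sup>\<beta>)\<close>.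

  If these errors exceed \<open>2R\<close> in total, then the centres met while the first \<open>R\<close> of error accumulates
  and those met while the last \<open>R\<close> accumulates form a rectangle of \<open>\<omega> \<times> \<omega>\<close>-weight at least \<open>R\<^sup>2\<close>,
  and one extra edge serves all pairs of centres in the rectangle. Buying edges for a maximal family
  of disjoint rectangles costs at most \<open>(\<Sum>c. \<omega> c)\<^sup>2 / R\<^sup>2 = O(n\<^sup>2 R\<^bsup>4\<beta> - 6\<^esup>) = O(n)\<close> edges. So \<open>\<beta>\<close> improves
  to \<open>1 / (6 - 4\<beta>)\<close>, and iterating from \<open>\<beta> = 1\<close> converges to the fixed point \<open>1 / (3 + \<surd>5)\<close>.
\<close>

section \<open>Hop distances and walks along weighted shortcuts\<close>

text \<open>For an unreachable pair the value is an unspecified number. Reachability is therefore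
  carried along separately, and edge sets are kept inside \<open>E\<^sup>*\<close>.\<close>

definition hop_dist :: "('a \<times> 'a) set \<Rightarrow> 'a \<Rightarrow> 'a \<Rightarrow> nat" where
  "hop_dist E s t = (LEAST k. (s, t) \<in> E ^^ k)"

lemma hop_dist_relpow: "(s, t) \<in> E\<^sup>* \<Longrightarrow> (s, t) \<in> E ^^ hop_dist E s t"
  unfolding hop_dist_def by (metis LeastI rtrancl_imp_relpow)

lemma hop_dist_le: "(s, t) \<in> E ^^ k \<Longrightarrow> hop_dist E s t \<le> k"
  unfolding hop_dist_def by (rule Least_le)

lemma hop_dist_refl [simp]: "hop_dist E s s = 0"
  using hop_dist_le[of s s 0 E] by simp

lemma hop_dist_triangle:
  assumes "(x, y) \<in> E\<^sup>*" "(y, z) \<in> E\<^sup>*"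
  shows "hop_dist E x z \<le> hop_dist E x y + hop_dist E y z"
  by (intro hop_dist_le) (use assms[THEN hop_dist_relpow] in \<open>auto simp: relpow_add\<close>)

lemma relpow_sym: "sym E \<Longrightarrow> (x, y) \<in> E ^^ k \<Longrightarrow> (y, x) \<in> E ^^ k"
proof (induction k arbitrary: y)
  case (Suc k)
  then obtain z where "(x, z) \<in> E ^^ k" "(z, y) \<in> E" by auto
  then show ?case using Suc by (meson relpow_Suc_I2 symD)
qed simp

lemma relpow_subset:
  fixes E E' :: "('a \<times> 'a) set"
  shows "(x, y) \<in> E ^^ k \<Longrightarrow> E \<subseteq> E' \<Longrightarrow> (x, y) \<in> E' ^^ k"
proof (induction k arbitrary: y)
  case (Suc k)
  then obtain z where "(x, z) \<in> E ^^ k" "(z, y) \<in> E" by auto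
  then show ?case using Suc by auto
qed simp

lemma hop_dist_sym: "sym E \<Longrightarrow> hop_dist E x y = hop_dist E y x"
  unfolding hop_dist_def by (metis relpow_sym)

lemma rtrancl_symD: "sym E \<Longrightarrow> (x, y) \<in> E\<^sup>* \<Longrightarrow> (y, x) \<in> E\<^sup>*"
  by (meson sym_rtrancl symD)

section \<open>Balls and spheres\<close>

definition hop_ball :: "('a \<times> 'a) set \<Rightarrow> 'a \<Rightarrow> nat \<Rightarrow> 'a set" where
  "hop_ball E c r = {v. (c, v) \<in> E\<^sup>* \<and> hop_dist E c v \<le> r}"

definition hop_sphere :: "('a \<times> 'a) set \<Rightarrow> 'a \<Rightarrow> nat \<Rightarrow> 'a set" where
  "hop_sphere E c r = {v. (c, v) \<in> E\<^sup>* \<and> hop_dist E c v = r}"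

lemma hop_ball_mono: "r \<le> s \<Longrightarrow> hop_ball E c r \<subseteq> hop_ball E c s"
  by (auto simp: hop_ball_def)

lemma centre_in_hop_ball [simp]: "c \<in> hop_ball E c r"
  by (simp add: hop_ball_def)

lemma rtrancl_vertex: "E \<subseteq> V \<times> V \<Longrightarrow> (x, y) \<in> E\<^sup>* \<Longrightarrow> x \<in> V \<Longrightarrow> y \<in> V"
  by (erule rtranclE) auto

lemma hop_ball_subset: "E \<subseteq> V \<times> V \<Longrightarrow> c \<in> V \<Longrightarrow> hop_ball E c r \<subseteq> V"
  by (auto simp: hop_ball_def dest: rtrancl_vertex)

text \<open>\<open>jump_walk E F x y l\<close>: the graph with edge set \<open>F\<close>, each edge weighted by its hop distance
  in \<open>E\<close>, has a walk from \<open>x\<close> to \<open>y\<close> of weight at most \<open>l\<close>.\<close>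

inductive jump_walk :: "('a \<times> 'a) set \<Rightarrow> ('a \<times> 'a) set \<Rightarrow> 'a \<Rightarrow> 'a \<Rightarrow> real \<Rightarrow> bool"
  for E F where
  stop: "0 \<le> l \<Longrightarrow> jump_walk E F x x l"
| jump: "(x, y) \<in> F \<or> (y, x) \<in> F \<Longrightarrow> real (hop_dist E x y) + l' \<le> l \<Longrightarrow> jump_walk E F y z l' \<Longrightarrow>
    jump_walk E F x z l"

lemma jump_walk_mono: "jump_walk E F x y l \<Longrightarrow> l \<le> l' \<Longrightarrow> F \<subseteq> F' \<Longrightarrow> jump_walk E F' x y l'"
proof (induction arbitrary: l' rule: jump_walk.induct)
  case (stop l x)
  then show ?case by (auto intro: jump_walk.stop)
next
  case (jump x y k l z)
  have "jump_walk E F' y z k" using jump by blast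
  then show ?case by (intro jump_walk.jump[of x y F' E k]) (use jump in auto)
qed

lemma jump_walk_trans:
  "jump_walk E F x y l \<Longrightarrow> jump_walk E F y z l' \<Longrightarrow> jump_walk E F x z (l + l')"
proof (induction rule: jump_walk.induct)
  case (stop l x)
  then show ?case by (rule_tac jump_walk_mono) auto
next
  case (jump x y k l z)
  then show ?case by (intro jump_walk.jump[of x y F E "k + l'"]) auto
qed

lemma jump_walk_edge:
  "(x, y) \<in> F \<or> (y, x) \<in> F \<Longrightarrow> real (hop_dist E x y) \<le> l \<Longrightarrow> jump_walk E F x y l"
  by (rule jump_walk.jump[of x y F E 0]) (auto intro: jump_walk.stop)

text \<open>Lifts a recursive emulator from the graph induced on a cluster to the whole graph: its
  edges were weighted by distances inside the cluster, and distances in the whole graph are no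
  larger.\<close>

lemma jump_walk_change_dist:
  "jump_walk E' F x y l \<Longrightarrow> (\<And>u v. (u, v) \<in> F \<or> (v, u) \<in> F \<Longrightarrow> hop_dist E u v \<le> hop_dist E' u v) \<Longrightarrow>
   jump_walk E F x y l"
proof (induction rule: jump_walk.induct)
  case (stop l x)
  then show ?case by (auto intro: jump_walk.stop)
next
  case (jump x y k l z)
  have "hop_dist E x y \<le> hop_dist E' x y" using jump by blast
  then have "real (hop_dist E x y) \<le> real (hop_dist E' x y)" by simp
  then have "real (hop_dist E x y) + k \<le> l" using jump(2) by linarith
  then show ?case using jump by (intro jump_walk.jump[of x y F E k]) auto
qed

section \<open>Leaving a ball along a path\<close>

text \<open>One step raises the distance from \<open>c\<close> by at most one, so a path cannot
  leave the ball without visiting a vertex at distance exactly \<open>\<rho>\<close>. The path is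
  cut at the first such vertex.\<close>

lemma relpow_exit_ball:
  assumes "(x, t) \<in> E ^^ k" "x \<in> hop_ball E c \<rho>" "t \<notin> hop_ball E c \<rho>"
  obtains y k1 k2 where "k = k1 + k2" "(x, y) \<in> (Restr E (hop_ball E c \<rho>)) ^^ k1"
    "(y, t) \<in> E ^^ k2" "y \<in> hop_sphere E c \<rho>"
  using assms
proof (induction k arbitrary: x thesis)
  case 0
  then show ?case by auto
next
  case (Suc k)
  show ?case
  proof (cases "hop_dist E c x = \<rho>")
    case True
    then show ?thesis using Suc(3,4) Suc(2)[of 0 "Suc k" x]
      by (auto simp: hop_ball_def hop_sphere_def)
  next
    case False
    obtain x' where x': "(x, x') \<in> E" "(x', t) \<in> E ^^ k"
      using Suc(3) by (meson relpow_Suc_E2)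
    have cx: "(c, x) \<in> E\<^sup>*" "hop_dist E c x \<le> \<rho>" using Suc(4) by (auto simp: hop_ball_def)
    have "(c, x') \<in> E ^^ Suc (hop_dist E c x)"
      using hop_dist_relpow[OF cx(1)] x'(1) by (auto simp: relcomp.simps)
    then have "hop_dist E c x' \<le> \<rho>" using False cx(2) hop_dist_le by fastforce
    moreover have "(c, x') \<in> E\<^sup>*" using cx x' by auto
    ultimately have ball: "x' \<in> hop_ball E c \<rho>" by (simp add: hop_ball_def)
    obtain y k1 k2 where *: "k = k1 + k2" "(x', y) \<in> (Restr E (hop_ball E c \<rho>)) ^^ k1"
      "(y, t) \<in> E ^^ k2" "y \<in> hop_sphere E c \<rho>"
      using Suc.IH[OF _ x'(2) ball Suc(5)] by metis
    have "(x, x') \<in> Restr E (hop_ball E c \<rho>)" using x' ball Suc(4) by auto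
    then have "(x, y) \<in> (Restr E (hop_ball E c \<rho>)) ^^ Suc k1"
      using *(2) by (rule relpow_Suc_I2)
    then show ?thesis using * Suc(2)[of "Suc k1" k2 y] by simp
  qed
qed

text \<open>The segment up to the exit point stays in the ball and is a shortest path there too, so an
  emulator of the graph induced on the ball can replace it.\<close>

lemma shortest_path_exits_ball:
  assumes "sym E" "x \<in> hop_ball E c \<rho>" "t \<notin> hop_ball E c \<rho>" "(x, t) \<in> E\<^sup>*"
  obtains y where "y \<in> hop_sphere E c \<rho>"
    "(x, y) \<in> (Restr E (hop_ball E c \<rho>)) ^^ hop_dist E x y" "(y, t) \<in> E\<^sup>*"
    "hop_dist E x t = hop_dist E x y + hop_dist E y t"
proof -
  obtain y k1 k2 where *: "hop_dist E x t = k1 + k2"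
      "(x, y) \<in> (Restr E (hop_ball E c \<rho>)) ^^ k1" "(y, t) \<in> E ^^ k2" "y \<in> hop_sphere E c \<rho>"
    using relpow_exit_ball[OF hop_dist_relpow[OF assms(4)] assms(2,3)] by metis
  have xy: "(x, y) \<in> E ^^ k1"
    using *(2) by (rule relpow_subset) auto
  have "(x, y) \<in> E\<^sup>*" "(y, t) \<in> E\<^sup>*" using xy *(3) relpow_imp_rtrancl by metis+
  moreover from this have "hop_dist E x t \<le> hop_dist E x y + hop_dist E y t"
    by (rule hop_dist_triangle)
  moreover have "hop_dist E x y \<le> k1" "hop_dist E y t \<le> k2" using xy *(3) hop_dist_le by metis+
  ultimately have "hop_dist E x y = k1" "hop_dist E y t = k2" using *(1) by linarith+
  then show ?thesis using * \<open>(y, t) \<in> E\<^sup>*\<close> by (intro that[of y]) auto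
qed

text \<open>Averaging: the \<open>r\<close> spheres of radius \<open>6 * r + 1\<close> up to
  \<open>7 * r\<close> are disjoint parts of one ball, so some sphere has at most the average
  size.\<close>

lemma thin_sphere_exists:
  assumes "finite (hop_ball E c (7 * r))" "0 < r"
  shows "\<exists>\<rho>. 6 * r < \<rho> \<and> \<rho> \<le> 7 * r \<and>
    r * card (hop_sphere E c \<rho>) \<le> card (hop_ball E c (7 * r))"
proof (rule ccontr)
  assume none: "\<not> ?thesis"
  have big: "card (hop_ball E c (7 * r)) < r * card (hop_sphere E c \<rho>)"
    if "\<rho> \<in> {6 * r<..7 * r}" for \<rho>
    using that none by (meson greaterThanAtMost_iff not_le)
  let ?B = "hop_ball E c (7 * r)"
  have sub: "(\<Union>\<rho>\<in>{6 * r<..7 * r}. hop_sphere E c \<rho>) \<subseteq> ?B"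
    by (auto simp: hop_sphere_def hop_ball_def)
  have "(\<Sum>\<rho>\<in>{6 * r<..7 * r}. card (hop_sphere E c \<rho>)) = card (\<Union>\<rho>\<in>{6 * r<..7 * r}. hop_sphere E c \<rho>)"
    by (rule card_UN_disjoint[symmetric])
      (use sub assms in \<open>auto simp: hop_sphere_def intro: finite_subset\<close>)
  also have "\<dots> \<le> card ?B" using sub assms by (intro card_mono)
  finally have "r * (\<Sum>\<rho>\<in>{6 * r<..7 * r}. card (hop_sphere E c \<rho>)) \<le> r * card ?B" by simp
  moreover have "(\<Sum>\<rho>\<in>{6 * r<..7 * r}. card ?B) < (\<Sum>\<rho>\<in>{6 * r<..7 * r}. r * card (hop_sphere E c \<rho>))"
    by (rule sum_strict_mono) (use big assms in auto)
  ultimately show False by (simp add: sum_distrib_left)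
qed

text \<open>Greedy choice: take a set of largest \<open>r\<close>, discard every set that meets it,
  and recurse. Nonemptiness makes the chosen set meet itself, so the remaining family shrinks. Balls
  are selected in this way, and with constant \<open>r\<close> a maximal disjoint family of
  rectangles.\<close>

lemma vitali_subfamily:
  fixes r :: "'a \<Rightarrow> nat"
  assumes "finite U" "\<And>v. v \<in> U \<Longrightarrow> B v \<noteq> {}"
  shows "\<exists>I\<subseteq>U. (\<forall>u\<in>I. \<forall>v\<in>I. u \<noteq> v \<longrightarrow> B u \<inter> B v = {}) \<and>
    (\<forall>v\<in>U. \<exists>c\<in>I. r v \<le> r c \<and> B v \<inter> B c \<noteq> {})"
  using assms
proof (induction "card U" arbitrary: U rule: less_induct)
  case less
  show ?case
  proof (cases "U = {}")
    case False
    have "Max (r ` U) \<in> r ` U" using less(2) False by (intro Max_in) auto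
    then obtain m where m: "m \<in> U" "\<And>v. v \<in> U \<Longrightarrow> r v \<le> r m"
      using less(2) by (metis (no_types, lifting) Max_ge finite_imageI imageE imageI)
    define U' where "U' = {u \<in> U. B u \<inter> B m = {}}"
    have "U' \<subset> U" using m less(3) by (auto simp: U'_def)
    then have "card U' < card U" "finite U'"
      using less(2) by (auto intro: psubset_card_mono finite_subset)
    then have "\<exists>I\<subseteq>U'. (\<forall>u\<in>I. \<forall>v\<in>I. u \<noteq> v \<longrightarrow> B u \<inter> B v = {}) \<and>
        (\<forall>v\<in>U'. \<exists>c\<in>I. r v \<le> r c \<and> B v \<inter> B c \<noteq> {})"
      by (rule less(1)) (auto simp: U'_def less(3))
    then obtain I where I: "I \<subseteq> U'" "\<forall>u\<in>I. \<forall>v\<in>I. u \<noteq> v \<longrightarrow> B u \<inter> B v = {}"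
      "\<forall>v\<in>U'. \<exists>c\<in>I. r v \<le> r c \<and> B v \<inter> B c \<noteq> {}"
      by metis
    show ?thesis
      by (rule exI[of _ "insert m I"]) (use I m in \<open>auto simp: U'_def\<close>)
  qed auto
qed

section \<open>Repairing distances in a system of clusters\<close>

text \<open>\<open>I\<close> holds the cluster centres, \<open>X\<close> the sphere vertices,
  \<open>\<omega>\<close> the error of one hop out of a cluster, \<open>R\<close> a bound for the
  radii. A vertex lies within \<open>2 * r\<close> of its centre while the sphere is beyond
  \<open>6 * r\<close>, which makes every hop long. \<open>hop\<close> speaks only of shortest paths
  inside the ball, as these are the paths that an emulator of the cluster can replace.\<close>

locale hub_system =
  fixes V :: "'a set" and E F :: "('a \<times> 'a) set" and I X :: "'a set"
    and r \<rho> :: "'a \<Rightarrow> nat" and ctr :: "'a \<Rightarrow> 'a" and \<omega> :: "'a \<Rightarrow> real" and R :: real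
  assumes finite_V: "finite V" and E_V: "E \<subseteq> V \<times> V" and sym_E: "sym E"
    and I_V: "I \<subseteq> V" and X_V: "X \<subseteq> V"
    and ctr: "x \<in> V \<Longrightarrow> ctr x \<in> I \<and> x \<in> hop_ball E (ctr x) (2 * r (ctr x))"
    and radius: "c \<in> I \<Longrightarrow> 6 * r c < \<rho> c \<and> \<rho> c \<le> 7 * r c \<and> real (r c) \<le> R"
    and star: "c \<in> I \<Longrightarrow> y \<in> hop_ball E c (7 * r c) \<Longrightarrow> (c, y) \<in> F"
    and sphere: "c \<in> I \<Longrightarrow> hop_sphere E c (\<rho> c) \<subseteq> X"
    and hop: "x \<in> X \<Longrightarrow> y \<in> hop_sphere E (ctr x) (\<rho> (ctr x)) \<Longrightarrow>
      (x, y) \<in> (Restr E (hop_ball E (ctr x) (\<rho> (ctr x)))) ^^ hop_dist E x y \<Longrightarrow>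
      jump_walk E F x y (hop_dist E x y + \<omega> (ctr x))"
    and \<omega>_nonneg: "c \<in> I \<Longrightarrow> 0 \<le> \<omega> c"
begin

section \<open>Star walks and exits from clusters\<close>

abbreviation "d \<equiv> hop_dist E"
abbreviation "W \<equiv> jump_walk E F"

lemma R_nonneg: "c \<in> I \<Longrightarrow> 0 \<le> R"
  using radius[of c] of_nat_0_le_iff[of "r c", where 'a = real] by linarith

lemma ctr_X: "x \<in> X \<Longrightarrow> ctr x \<in> I"
  using ctr X_V by auto

lemma ctr_connected: "x \<in> V \<Longrightarrow> (ctr x, x) \<in> E\<^sup>*" "x \<in> V \<Longrightarrow> (x, ctr x) \<in> E\<^sup>*"
  using ctr[of x] rtrancl_symD[OF sym_E] by (auto simp: hop_ball_def)

lemma ctr_dist: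
  assumes "x \<in> V"
  shows "d (ctr x) x \<le> 2 * r (ctr x)" "d x (ctr x) \<le> 2 * r (ctr x)"
    "real (d (ctr x) x) \<le> 2 * R" "real (d x (ctr x)) \<le> 2 * R"
proof -
  show *: "d (ctr x) x \<le> 2 * r (ctr x)" using ctr[of x] assms by (auto simp: hop_ball_def)
  show "d x (ctr x) \<le> 2 * r (ctr x)" using * hop_dist_sym[OF sym_E, of x] by simp
  show "real (d (ctr x) x) \<le> 2 * R" using * radius ctr assms by fastforce
  then show "real (d x (ctr x)) \<le> 2 * R" using hop_dist_sym[OF sym_E, of x] by simp
qed

lemma walk_star:
  assumes "c \<in> I" "y \<in> hop_ball E c (7 * r c)"
  shows "W c y (7 * R)" "W y c (7 * R)"
proof -
  have "d c y \<le> 7 * r c" using assms by (auto simp: hop_ball_def)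
  then have le: "real (d c y) \<le> 7 * R" using radius[OF assms(1)] by linarith
  then show "W c y (7 * R)" using star[OF assms] by (intro jump_walk_edge) auto
  show "W y c (7 * R)" using star[OF assms] le hop_dist_sym[OF sym_E, of y c]
    by (intro jump_walk_edge) auto
qed

lemma walk_ctr:
  assumes "x \<in> V"
  shows "W (ctr x) x (2 * R)" "W x (ctr x) (2 * R)"
proof -
  have "x \<in> hop_ball E (ctr x) (7 * r (ctr x))"
    using ctr[OF assms] hop_ball_mono[of "2 * r (ctr x)" "7 * r (ctr x)" E] by auto
  then have "(ctr x, x) \<in> F" using star ctr assms by blast
  then show "W (ctr x) x (2 * R)" "W x (ctr x) (2 * R)"
    using ctr_dist[OF assms] by (auto intro: jump_walk_edge)
qed

text \<open>The gap between \<open>2 * r\<close> and \<open>6 * r\<close> makes a hop longer than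
  the distance between any two vertices assigned to this centre. This later excludes two hops from
  the same centre.\<close>

lemma sphere_dist:
  assumes "x \<in> V" "y \<in> hop_sphere E (ctr x) (\<rho> (ctr x))" "(x, y) \<in> E\<^sup>*"
  shows "4 * r (ctr x) < d x y"
proof -
  have "d (ctr x) y \<le> d (ctr x) x + d x y"
    using ctr_connected assms by (intro hop_dist_triangle) auto
  then show ?thesis using assms(2) radius[of "ctr x"] ctr_dist[of x] ctr[of x] assms(1)
    by (auto simp: hop_sphere_def)
qed

lemma exit_cluster:
  assumes "x \<in> V" "(x, t) \<in> E\<^sup>*" "t \<notin> hop_ball E (ctr x) (\<rho> (ctr x))"
  obtains y where "y \<in> X" "y \<in> hop_sphere E (ctr x) (\<rho> (ctr x))"
    "(x, y) \<in> (Restr E (hop_ball E (ctr x) (\<rho> (ctr x)))) ^^ d x y"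
    "(x, y) \<in> E\<^sup>*" "(y, t) \<in> E\<^sup>*" "d x t = d x y + d y t" "4 * r (ctr x) < d x y"
proof -
  have "x \<in> hop_ball E (ctr x) (\<rho> (ctr x))"
    using ctr[OF assms(1)] radius[of "ctr x"] hop_ball_mono[of "2 * r (ctr x)" "\<rho> (ctr x)" E] by auto
  then obtain y where y: "y \<in> hop_sphere E (ctr x) (\<rho> (ctr x))"
      "(x, y) \<in> (Restr E (hop_ball E (ctr x) (\<rho> (ctr x)))) ^^ d x y" "(y, t) \<in> E\<^sup>*"
      "d x t = d x y + d y t"
    using shortest_path_exits_ball[OF sym_E _ assms(3) assms(2)] by metis
  have "(x, y) \<in> E\<^sup>*" using rtrancl_trans[OF assms(2) rtrancl_symD[OF sym_E y(3)]] .
  then show ?thesis using that[of y] y sphere_dist[OF assms(1) y(1)] sphere[of "ctr x"] ctr[OF assms(1)]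
    by auto
qed

section \<open>Chains of hops along a shortest path\<close>

text \<open>Induction on the distance to \<open>t\<close>, which drops at each hop because hops have
  positive length. The construction stops once the ball of the current vertex contains
  \<open>t\<close>.\<close>

lemma chain_exists:
  assumes "s \<in> X" "(s, t) \<in> E\<^sup>*"
  shows "\<exists>x m. x 0 = s \<and> (\<forall>l\<le>m. x l \<in> X \<and> (x l, t) \<in> E\<^sup>*) \<and>
    t \<in> hop_ball E (ctr (x m)) (\<rho> (ctr (x m))) \<and>
    (\<forall>l<m. x (Suc l) \<in> hop_sphere E (ctr (x l)) (\<rho> (ctr (x l))) \<and>
      W (x l) (x (Suc l)) (d (x l) (x (Suc l)) + \<omega> (ctr (x l))) \<and>
      (x l, x (Suc l)) \<in> E\<^sup>* \<and>
      d (x l) t = d (x l) (x (Suc l)) + d (x (Suc l)) t)"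
  using assms
proof (induction "d s t" arbitrary: s rule: less_induct)
  case less
  show ?case
  proof (cases "t \<in> hop_ball E (ctr s) (\<rho> (ctr s))")
    case True
    then show ?thesis using less(2,3) by (intro exI[of _ "\<lambda>_. s"] exI[of _ 0]) auto
  next
    case False
    have "s \<in> V" using less X_V by auto
    then obtain y where y: "y \<in> X" "y \<in> hop_sphere E (ctr s) (\<rho> (ctr s))"
        "(s, y) \<in> (Restr E (hop_ball E (ctr s) (\<rho> (ctr s)))) ^^ d s y"
        "(s, y) \<in> E\<^sup>*" "(y, t) \<in> E\<^sup>*" "d s t = d s y + d y t" "4 * r (ctr s) < d s y"
      using exit_cluster[OF _ less(3) False] by metis
    then obtain x m where x: "x 0 = y" "\<forall>l\<le>m. x l \<in> X \<and> (x l, t) \<in> E\<^sup>*"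
        "t \<in> hop_ball E (ctr (x m)) (\<rho> (ctr (x m)))"
        "\<forall>l<m. x (Suc l) \<in> hop_sphere E (ctr (x l)) (\<rho> (ctr (x l))) \<and>
          W (x l) (x (Suc l)) (d (x l) (x (Suc l)) + \<omega> (ctr (x l))) \<and>
          (x l, x (Suc l)) \<in> E\<^sup>* \<and>
          d (x l) t = d (x l) (x (Suc l)) + d (x (Suc l)) t"
      using less(1)[of y] by auto
    have W: "W s y (d s y + \<omega> (ctr s))" using hop y less(2) by auto
    define x' where "x' = case_nat s x"
    have x'0: "x' 0 = s" and x'S: "x' (Suc l) = x l" for l by (auto simp: x'_def)
    show ?thesis
    proof (intro exI[of _ x'] exI[of _ "Suc m"] conjI allI impI)
      fix l assume "l \<le> Suc m"
      then show "x' l \<in> X" "(x' l, t) \<in> E\<^sup>*"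
        by (cases l; use x less(2,3) in \<open>auto simp: x'0 x'S\<close>)+
    next
      fix l assume "l < Suc m"
      then show "x' (Suc l) \<in> hop_sphere E (ctr (x' l)) (\<rho> (ctr (x' l)))"
         "W (x' l) (x' (Suc l)) (d (x' l) (x' (Suc l)) + \<omega> (ctr (x' l)))"
          "(x' l, x' (Suc l)) \<in> E\<^sup>*"
          "d (x' l) t = d (x' l) (x' (Suc l)) + d (x' (Suc l)) t"
        by (cases l; use x y W in \<open>simp add: x'0 x'S\<close>)+
    qed (use x in \<open>auto simp: x'0 x'S\<close>)
  qed
qed

text \<open>Either the local errors along a shortest path are small in total, or a set \<open>A\<close> of centres near
  its start and a set \<open>B\<close> of centres near its end both have weight at least \<open>T\<close>. In the second case
  the single pair \<open>(p, q)\<close> repairs the distances between all of \<open>A\<close> and all of \<open>B\<close>, and any good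
  connection between \<open>A\<close> and \<open>B\<close> repairs the distance from \<open>s\<close> to \<open>t\<close>.\<close>

definition repairable :: "real \<Rightarrow> 'a \<Rightarrow> 'a \<Rightarrow> 'a set \<Rightarrow> 'a set \<Rightarrow> 'a \<Rightarrow> 'a \<Rightarrow> bool" where
  "repairable T s t A B p q \<longleftrightarrow> A \<subseteq> I \<and> B \<subseteq> I \<and> p \<in> I \<and> q \<in> I \<and> (p, q) \<in> E\<^sup>* \<and>
    T \<le> sum \<omega> A \<and> T \<le> sum \<omega> B \<and>
    (\<forall>a\<in>A. \<forall>b\<in>B.
      (\<exists>u v. W s a u \<and> W b t v \<and> u + v + real (d a b) \<le> real (d s t) + 2 * T + 23 * R) \<and>
      (\<exists>u v. W a p u \<and> W q b v \<and> u + v + real (d p q) \<le> real (d a b) + 2 * T + 21 * R))"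

lemma repairable_ends:
  fixes T :: real
  assumes "repairable T s t A B p q" "a \<in> A" "b \<in> B"
  obtains u v :: real where "W s a u" "W b t v" "u + v + d a b \<le> d s t + 2 * T + 23 * R"
  using assms unfolding repairable_def by blast

lemma repairable_bridge:
  fixes T :: real
  assumes "repairable T s t A B p q" "a \<in> A" "b \<in> B"
  obtains u v :: real where "W a p u" "W q b v" "u + v + d p q \<le> d a b + 2 * T + 21 * R"
  using assms unfolding repairable_def by blast

text \<open>The hop errors are split at the first index \<open>i\<close> where the prefix reaches
  \<open>T\<close> and the last index \<open>j\<close> where the suffix reaches \<open>T\<close>.
  Errors before \<open>i\<close> and errors after \<open>j\<close> stay below \<open>T\<close>, so
  walks there are cheap, while including \<open>i\<close> and \<open>j\<close> makes both sets of
  centres heavy.\<close>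

lemma light_or_repairable:
  fixes T :: real
  assumes s: "s \<in> X" and st: "(s, t) \<in> E\<^sup>*" and "0 < T"
  shows "W s t (d s t + 2 * T + 9 * R) \<or> (\<exists>A B p q. repairable T s t A B p q)"
proof -
  obtain x m where x0: "x 0 = s" and on_path: "\<forall>l\<le>m. x l \<in> X \<and> (x l, t) \<in> E\<^sup>*"
    and last: "t \<in> hop_ball E (ctr (x m)) (\<rho> (ctr (x m)))"
    and steps: "\<forall>l<m. x (Suc l) \<in> hop_sphere E (ctr (x l)) (\<rho> (ctr (x l))) \<and>
      W (x l) (x (Suc l)) (d (x l) (x (Suc l)) + \<omega> (ctr (x l))) \<and>
      (x l, x (Suc l)) \<in> E\<^sup>* \<and>
      d (x l) t = d (x l) (x (Suc l)) + d (x (Suc l)) t"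
    using chain_exists[OF s st] by (elim exE conjE)
  have xX: "\<And>l. l \<le> m \<Longrightarrow> x l \<in> X" and xt: "\<And>l. l \<le> m \<Longrightarrow> (x l, t) \<in> E\<^sup>*"
    using on_path by auto
  have sph: "\<And>l. l < m \<Longrightarrow> x (Suc l) \<in> hop_sphere E (ctr (x l)) (\<rho> (ctr (x l)))"
    and stepW: "\<And>l. l < m \<Longrightarrow> W (x l) (x (Suc l)) (d (x l) (x (Suc l)) + \<omega> (ctr (x l)))"
    and con: "\<And>l. l < m \<Longrightarrow> (x l, x (Suc l)) \<in> E\<^sup>*"
    and add: "\<And>l. l < m \<Longrightarrow> d (x l) t = d (x l) (x (Suc l)) + d (x (Suc l)) t"
    using steps by auto
  \<comment> \<open>\<open>h\<close> is the distance left to \<open>t\<close>. As the chain lies on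
    a shortest path, distances between its vertices are differences of \<open>h\<close>.\<close>
  define h where "h l = real (d (x l) t)" for l
  define c where "c l = ctr (x l)" for l
  define e where "e l = \<omega> (c l)" for l
  have xV: "l \<le> m \<Longrightarrow> x l \<in> V" for l using xX X_V by auto
  have cI: "l \<le> m \<Longrightarrow> c l \<in> I" for l using ctr_X xX by (auto simp: c_def)
  have e0: "l \<le> m \<Longrightarrow> 0 \<le> e l" for l using \<omega>_nonneg cI by (auto simp: e_def)
  have seg: "(x l, x k) \<in> E\<^sup>* \<and> W (x l) (x k) (h l - h k + sum e {l..<k}) \<and>
      real (d (x l) (x k)) = h l - h k" if "l \<le> k" "k \<le> m" for l k
    using that
  proof (induction k rule: dec_induct)
    case base
    then show ?case by (auto intro: jump_walk.stop)
  next
    case (step k)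
    have k: "k < m" using step by simp
    have IH: "(x l, x k) \<in> E\<^sup>*" "W (x l) (x k) (h l - h k + sum e {l..<k})"
      "real (d (x l) (x k)) = h l - h k" using step by auto
    have ad: "h k - h (Suc k) = real (d (x k) (x (Suc k)))" using add[OF k] by (simp add: h_def)
    have "W (x k) (x (Suc k)) (h k - h (Suc k) + e k)"
      using stepW[OF k] ad by (simp add: e_def c_def)
    from jump_walk_trans[OF IH(2) this]
    have W: "W (x l) (x (Suc k)) (h l - h (Suc k) + sum e {l..<Suc k})"
      using step(1) by (simp add: algebra_simps)
    have rt: "(x l, x (Suc k)) \<in> E\<^sup>*" using IH(1) con[OF k] by simp
    have "d (x l) (x (Suc k)) \<le> d (x l) (x k) + d (x k) (x (Suc k))"
      using IH(1) con[OF k] by (rule hop_dist_triangle)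
    then have "real (d (x l) (x (Suc k))) \<le> h l - h (Suc k)" using IH(3) ad by linarith
    moreover have "d (x l) t \<le> d (x l) (x (Suc k)) + d (x (Suc k)) t"
      using rt xt[of "Suc k"] k by (intro hop_dist_triangle) auto
    ultimately show ?case using rt W by (simp add: h_def)
  qed
  have hmono: "h k \<le> h l" if "l \<le> k" "k \<le> m" for l k
    using seg[OF that] of_nat_0_le_iff[of "d (x l) (x k)", where 'a = real] by linarith
  have xc: "W (x l) (c l) (2 * R)" "W (c l) (x l) (2 * R)" "(x l, c l) \<in> E\<^sup>*" "(c l, x l) \<in> E\<^sup>*"
    "real (d (x l) (c l)) \<le> 2 * R" "real (d (c l) (x l)) \<le> 2 * R" if "l \<le> m" for l
    using walk_ctr[OF xV[OF that]] ctr_connected[OF xV[OF that]] ctr_dist[OF xV[OF that]]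
    by (auto simp: c_def)
  \<comment> \<open>The star edge from the centre reaches the exit point directly, so moving on from
    \<open>c l\<close> avoids the error \<open>e l\<close>.\<close>
  have cx: "W (c l) (x (Suc l)) (7 * R)" if "l < m" for l
  proof -
    have "x (Suc l) \<in> hop_ball E (c l) (7 * r (c l))"
      using sph[OF that] radius[OF cI[of l]] that by (auto simp: c_def hop_ball_def hop_sphere_def)
    then show ?thesis using walk_star cI[of l] that by simp
  qed
  have last_W: "W (x m) t (9 * R)"
  proof -
    have "t \<in> hop_ball E (c m) (7 * r (c m))"
      using last radius[OF cI[of m]] by (auto simp: c_def hop_ball_def)
    from jump_walk_trans[OF xc(1) walk_star(1)[OF cI this]] show ?thesis by simp
  qed
  have cc: "(c a, c b) \<in> E\<^sup>*" "real (d (c a) (c b)) \<le> h a - h b + 4 * R"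
      "h a - h b \<le> real (d (c a) (c b)) + 4 * R" if "a \<le> b" "b \<le> m" for a b
  proof -
    have am: "a \<le> m" using that by simp
    show ab: "(c a, c b) \<in> E\<^sup>*"
      using xc(4)[OF am] seg[OF that] xc(3)[OF that(2)] by (meson rtrancl_trans)
    have "d (c a) (c b) \<le> d (c a) (x b) + d (x b) (c b)"
      using xc(4)[OF am] seg[OF that] xc(3)[OF that(2)] by (intro hop_dist_triangle) auto
    moreover have "d (c a) (x b) \<le> d (c a) (x a) + d (x a) (x b)"
      using xc(4)[OF am] seg[OF that] by (intro hop_dist_triangle) auto
    ultimately show "real (d (c a) (c b)) \<le> h a - h b + 4 * R"
      using xc(6)[OF am] xc(5)[OF that(2)] seg[OF that] by linarith
    have "d (x a) (x b) \<le> d (x a) (c b) + d (c b) (x b)"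
      using xc(3)[OF am] ab xc(4)[OF that(2)] by (intro hop_dist_triangle) auto
    moreover have "d (x a) (c b) \<le> d (x a) (c a) + d (c a) (c b)"
      using xc(3)[OF am] ab by (intro hop_dist_triangle) auto
    ultimately show "h a - h b \<le> real (d (c a) (c b)) + 4 * R"
      using xc(5)[OF am] xc(6)[OF that(2)] seg[OF that] by linarith
  qed
  have R0: "0 \<le> R" using R_nonneg cI[of 0] by simp
  have hm0: "0 \<le> h m" and h0: "h 0 = real (d s t)" by (simp_all add: h_def x0)
  \<comment> \<open>With a common centre, \<open>x l\<close> and \<open>x k\<close> are within
    \<open>4 * r (c l)\<close> of each other, but the first hop from \<open>x l\<close> towards
    \<open>x k\<close> is already longer. Distinctness turns sums over indices into sums over sets
    of centres.\<close>
  have "c l \<noteq> c k" if "l < k" "k < m" for l k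
  proof
    assume eq: "c l = c k"
    have lm: "l < m" "l \<le> m" "k \<le> m" using that by auto
    have "d (x l) (x k) \<le> d (x l) (c l) + d (c k) (x k)"
      unfolding eq[symmetric] using xc(3)[OF lm(2)] xc(4)[OF lm(3)] eq by (intro hop_dist_triangle) auto
    also have "\<dots> \<le> 4 * r (c l)"
      using ctr_dist(2)[OF xV[OF lm(2)]] ctr_dist(1)[OF xV[OF lm(3)]] eq by (auto simp: c_def)
    also have "\<dots> < d (x l) (x (Suc l))"
      using sphere_dist[OF xV[OF lm(2)] sph[OF lm(1)] con[OF lm(1)]] by (simp add: c_def)
    finally have "h l - h k < h l - h (Suc l)"
      using seg[of l k] seg[of l "Suc l"] that lm by (metis Suc_leI less_imp_le of_nat_less_iff lessI)
    then show False using hmono[of "Suc l" k] that by auto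
  qed
  then have inj: "inj_on c {..<m}" by (intro inj_onI) (metis lessThan_iff nat_neq_iff)
  show ?thesis
  proof (cases "sum e {..<m} \<le> 2 * T")
    case True
    have "W (x 0) t (h 0 - h m + sum e {0..<m} + 9 * R)"
      using jump_walk_trans[OF _ last_W] seg[of 0 m] by auto
    then have "W s t (d s t + 2 * T + 9 * R)" unfolding x0
      by (rule jump_walk_mono) (use True in \<open>auto simp: h_def x0 atLeast0LessThan\<close>)
    then show ?thesis ..
  next
    case False
    define i where "i = (LEAST i. T \<le> sum e {..<Suc i})"
    define j where "j = (GREATEST j. j < m \<and> T \<le> sum e {j..<m})"
    have "m \<noteq> 0" using False \<open>0 < T\<close> by (cases m) auto
    then have m1: "T \<le> sum e {..<Suc (m - 1)}" using False \<open>0 < T\<close> by simp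
    have i: "T \<le> sum e {..<Suc i}" unfolding i_def using m1 by (rule LeastI)
    have "i \<le> m - 1" unfolding i_def using m1 by (rule Least_le)
    then have im: "i < m" using \<open>m \<noteq> 0\<close> by simp
    have pre: "sum e {..<i} < T"
    proof (cases i)
      case (Suc k)
      then show ?thesis using not_less_Least[of k "\<lambda>i. T \<le> sum e {..<Suc i}"] by (auto simp: i_def)
    qed (use \<open>0 < T\<close> in simp)
    have "0 < m \<and> T \<le> sum e {0..<m}" using False \<open>0 < T\<close> \<open>m \<noteq> 0\<close> by (simp add: atLeast0LessThan)
    then have j: "j < m \<and> T \<le> sum e {j..<m}"
      unfolding j_def by (rule GreatestI_nat[where b = m]) auto
    have suf: "sum e {Suc j..<m} < T"
    proof (cases "Suc j < m")
      case True
      have "\<not> (T \<le> sum e {Suc j..<m})"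
        using Greatest_le_nat[of "\<lambda>j. j < m \<and> T \<le> sum e {j..<m}" "Suc j" m] True
        by (auto simp: j_def)
      then show ?thesis by simp
    qed (use \<open>0 < T\<close> in simp)
    \<comment> \<open>Otherwise the prefix before \<open>i\<close> and the suffix after
      \<open>j\<close> cover all indices, and the total error is below \<open>2 * T\<close>.\<close>
    have "i \<le> j"
    proof (rule ccontr)
      assume "\<not> i \<le> j"
      have "sum e {..<m} = sum e {..<i} + sum e {i..<m}"
        using im sum.atLeastLessThan_concat[of 0 i m e] by (simp add: atLeast0LessThan)
      also have "sum e {i..<m} \<le> sum e {Suc j..<m}"
        using \<open>\<not> i \<le> j\<close> by (intro sum_mono2) (auto intro: e0)
      finally show False using pre suf False by simp
    qed
    have pre': "sum e {a..<i} < T" for a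
    proof -
      have "sum e {a..<i} \<le> sum e {..<i}" using im by (intro sum_mono2) (auto intro!: e0)
      then show ?thesis using pre by simp
    qed
    have suf': "sum e {Suc j..<b} < T" if "b \<le> m" for b
    proof -
      have "sum e {Suc j..<b} \<le> sum e {Suc j..<m}" using that by (intro sum_mono2) (auto intro!: e0)
      then show ?thesis using suf by simp
    qed
    have suf'': "sum e {Suc b..<m} < T" if "j \<le> b" for b
    proof -
      have "sum e {Suc b..<m} \<le> sum e {Suc j..<m}" using that by (intro sum_mono2) (auto intro!: e0)
      then show ?thesis using suf by simp
    qed
    have im': "i \<le> m" and jm: "j < m" "j \<le> m" using im j by auto
    have sub: "{..i} \<subseteq> {..<m}" "{j..<m} \<subseteq> {..<m}" using im by auto
    have "repairable T s t (c ` {..i}) (c ` {j..<m}) (c i) (c j)"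
      unfolding repairable_def
    proof (intro conjI ballI)
      show "c ` {..i} \<subseteq> I" "c ` {j..<m} \<subseteq> I" "c i \<in> I" "c j \<in> I" using cI im jm by auto
      show "(c i, c j) \<in> E\<^sup>*" using cc \<open>i \<le> j\<close> jm by auto
      show "T \<le> sum \<omega> (c ` {..i})"
        using i sum.reindex[OF inj_on_subset[OF inj sub(1)], of \<omega>]
        by (simp add: e_def lessThan_Suc_atMost)
      show "T \<le> sum \<omega> (c ` {j..<m})"
        using j sum.reindex[OF inj_on_subset[OF inj sub(2)], of \<omega>] by (simp add: e_def)
    next
      fix a' b' assume "a' \<in> c ` {..i}" "b' \<in> c ` {j..<m}"
      then obtain a b where a: "a' = c a" "a \<le> i" and b: "b' = c b" "j \<le> b" "b < m" by auto
      have ab: "a \<le> b" "a \<le> m" "b \<le> m" "Suc b \<le> m" using a b \<open>i \<le> j\<close> by auto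
      have "sum e {0..<a} < T"
      proof -
        have "sum e {0..<a} \<le> sum e {..<i}" using a im by (intro sum_mono2) (auto intro!: e0)
        then show ?thesis using pre by simp
      qed
      moreover have "W s (c a) (h 0 - h a + sum e {0..<a} + 2 * R)"
        using jump_walk_trans[OF _ xc(1)[OF ab(2)]] seg[of 0 a] ab x0 by auto
      moreover have "W (c b) t (7 * R + (h (Suc b) - h m + sum e {Suc b..<m}) + 9 * R)"
        using seg[of "Suc b" m] b by (intro jump_walk_trans[OF jump_walk_trans[OF cx[OF b(3)]] last_W]) auto
      \<comment> \<open>The multiples of \<open>R\<close> are 2 for entering \<open>c a\<close>, 7
        for leaving \<open>c b\<close>, 9 for the end at \<open>t\<close>, and 4 for comparing
        \<open>d (c a) (c b)\<close> with \<open>h\<close>.\<close>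
      moreover have "h 0 - h a + sum e {0..<a} + 2 * R +
          (7 * R + (h (Suc b) - h m + sum e {Suc b..<m}) + 9 * R) + d (c a) (c b)
          \<le> h 0 + 2 * T + 23 * R"
        using cc(2)[OF ab(1,3)] hmono[of b "Suc b"] ab suf''[OF b(2)] \<open>sum e {0..<a} < T\<close> R0 hm0
        by linarith
      ultimately show "\<exists>u v::real. W s a' u \<and> W b' t v \<and> u + v + d a' b' \<le> d s t + 2 * T + 23 * R"
        unfolding a(1) b(1) h0 by blast
      have "W (c a) (c i) (2 * R + (h a - h i + sum e {a..<i}) + 2 * R)"
        using seg[of a i] a im
        by (intro jump_walk_trans[OF jump_walk_trans[OF xc(2)[OF ab(2)]] xc(1)[OF im']]) auto
      \<comment> \<open>The star edge from \<open>c j\<close> leads to \<open>x (Suc j)\<close>,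
        which overshoots if \<open>b = j\<close>; the empty walk serves that case.\<close>
      moreover have "W (c j) (c b) (7 * R + (h j - h b + T) + 2 * R)"
      proof (cases "b = j")
        case True
        show ?thesis using R0 True \<open>0 < T\<close> by (auto intro: jump_walk.stop)
      next
        case False
        then have sb: "Suc j \<le> b" using b by simp
        have "W (c j) (c b) (7 * R + (h (Suc j) - h b + sum e {Suc j..<b}) + 2 * R)"
          using seg[OF sb] ab
          by (intro jump_walk_trans[OF jump_walk_trans[OF cx[OF jm(1)]] xc(1)[OF ab(3)]]) auto
        then show ?thesis
          by (rule jump_walk_mono) (use suf'[OF ab(3)] hmono[of j "Suc j"] jm in auto)
      qed
      \<comment> \<open>Here 21 is 4 for the walk to \<open>c i\<close>, 9 for the walk from
        \<open>c j\<close>, and twice 4 for comparing centre distances with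
        \<open>h\<close>.\<close>
      moreover have "2 * R + (h a - h i + sum e {a..<i}) + 2 * R + (7 * R + (h j - h b + T) + 2 * R)
          + d (c i) (c j) \<le> d (c a) (c b) + 2 * T + 21 * R"
        using cc(2)[OF \<open>i \<le> j\<close> jm(2)] cc(3)[OF ab(1,3)] pre'[of a] by simp
      ultimately show "\<exists>u v::real. W a' (c i) u \<and> W (c j) b' v \<and>
          u + v + d (c i) (c j) \<le> d a' b' + 2 * T + 21 * R"
        unfolding a(1) b(1) by blast
    qed
    then show ?thesis by blast
  qed
qed

text \<open>One edge is bought per rectangle of a maximal disjoint family. The rectangle of any bad
  pair shares some \<open>(a, b)\<close> with a chosen one, so a walk runs from \<open>s\<close> to
  \<open>a\<close>, over the bought edge to \<open>b\<close>, and on to \<open>t\<close>. Disjoint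
  rectangles of weight at least \<open>T\<^sup>2\<close> fit into \<open>I \<times> I\<close>, which
  bounds their number.\<close>

theorem repair_edges:
  fixes T :: real
  assumes "0 < T"
  shows "\<exists>M. M \<subseteq> I \<times> I \<and> M \<subseteq> E\<^sup>* \<and> real (card M) * T\<^sup>2 \<le> (sum \<omega> I)\<^sup>2 \<and>
    (\<forall>s\<in>V. \<forall>t. (s, t) \<in> E\<^sup>* \<longrightarrow> jump_walk E (F \<union> M) s t (d s t + 4 * T + 53 * R))"
proof -
  have finI: "finite I" using finite_subset[OF I_V finite_V] .
  define H where "H = {(s, t). s \<in> X \<and> (s, t) \<in> E\<^sup>* \<and> \<not> W s t (d s t + 2 * T + 9 * R)}"
  have "H \<subseteq> V \<times> V" using X_V rtrancl_vertex[OF E_V] by (auto simp: H_def)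
  then have finH: "finite H" using finite_V by (meson finite_SigmaI finite_subset)
  have "\<exists>A B p q. repairable T (fst z) (snd z) A B p q" if "z \<in> H" for z
  proof -
    have "fst z \<in> X" "(fst z, snd z) \<in> E\<^sup>*"
        "\<not> W (fst z) (snd z) (d (fst z) (snd z) + 2 * T + 9 * R)"
      using that by (auto simp: H_def)
    then show ?thesis using light_or_repairable[OF _ _ assms] by blast
  qed
  then obtain A B p q where
    rep: "\<And>z. z \<in> H \<Longrightarrow> repairable T (fst z) (snd z) (A z) (B z) (p z) (q z)" by metis
  define P where "P z = A z \<times> B z" for z
  have "P z \<noteq> {}" if "z \<in> H" for z
    using rep[OF that] assms by (auto simp: P_def repairable_def)
  then obtain J where J: "J \<subseteq> H" "\<forall>u\<in>J. \<forall>v\<in>J. u \<noteq> v \<longrightarrow> P u \<inter> P v = {}"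
      "\<forall>v\<in>H. \<exists>u\<in>J. P v \<inter> P u \<noteq> {}"
    using vitali_subfamily[OF finH, of P "\<lambda>_. 0"] by auto
  define M where "M = (\<lambda>z. (p z, q z)) ` J"
  have finJ: "finite J" using finite_subset[OF J(1) finH] .
  have P_I: "P z \<subseteq> I \<times> I" if "z \<in> J" for z
    using rep[of z] J that by (auto simp: P_def repairable_def)
  let ?w = "\<lambda>(a, b). \<omega> a * \<omega> b"
  have "T\<^sup>2 \<le> sum ?w (P z)" if "z \<in> J" for z
  proof -
    have "T \<le> sum \<omega> (A z)" "T \<le> sum \<omega> (B z)" using rep[of z] J that by (auto simp: repairable_def)
    then have "T * T \<le> sum \<omega> (A z) * sum \<omega> (B z)" using assms by (intro mult_mono) auto
    then show ?thesis by (simp add: P_def power2_eq_square sum_product sum.cartesian_product)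
  qed
  then have "real (card J) * T\<^sup>2 \<le> (\<Sum>z\<in>J. sum ?w (P z))"
    using sum_bounded_below[of J "T\<^sup>2"] by simp
  also have "\<dots> = sum ?w (\<Union>z\<in>J. P z)"
    by (rule sum.UNION_disjoint[symmetric])
      (use finJ J P_I finI in \<open>auto intro: finite_subset[OF P_I]\<close>)
  also have "\<dots> \<le> sum ?w (I \<times> I)"
    using P_I finI \<omega>_nonneg by (intro sum_mono2) auto
  also have "\<dots> = (sum \<omega> I)\<^sup>2"
    by (simp add: power2_eq_square sum_product sum.cartesian_product)
  finally have "real (card J) * T\<^sup>2 \<le> (sum \<omega> I)\<^sup>2" .
  moreover have "real (card M) * T\<^sup>2 \<le> real (card J) * T\<^sup>2"
    using card_image_le[OF finJ] by (intro mult_right_mono) (auto simp: M_def)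
  ultimately have cardM: "real (card M) * T\<^sup>2 \<le> (sum \<omega> I)\<^sup>2" by simp
  have MI: "M \<subseteq> I \<times> I" "M \<subseteq> E\<^sup>*" using rep J by (auto simp: M_def repairable_def)
  have WM: "jump_walk E (F \<union> M) x y l" if "W x y l" for x y l
    using that by (rule jump_walk_mono) auto
  \<comment> \<open>The error is \<open>2 * T + 23 * R\<close> for reaching \<open>a\<close> and
    \<open>b\<close> plus \<open>2 * T + 21 * R\<close> for the bridge between them.\<close>
  have X: "jump_walk E (F \<union> M) s t (d s t + 4 * T + 44 * R)" if "s \<in> X" "(s, t) \<in> E\<^sup>*" for s t
  proof -
    have "0 \<le> R" using R_nonneg ctr_X[OF that(1)] by simp
    show ?thesis
    proof (cases "(s, t) \<in> H")
      case False
      then have "W s t (d s t + 2 * T + 9 * R)" using that by (auto simp: H_def)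
      then show ?thesis by (rule jump_walk_mono) (use assms \<open>0 \<le> R\<close> in auto)
    next
      case True
      then obtain z a b where z: "z \<in> J" "a \<in> A (s, t)" "b \<in> B (s, t)" "a \<in> A z" "b \<in> B z"
        using J(3) by (fastforce simp: P_def)
      have zH: "z \<in> H" using z J by auto
      obtain u v :: real where uv: "W s a u" "W b t v" "u + v + d a b \<le> d s t + 2 * T + 23 * R"
        using repairable_ends[OF rep[OF True] z(2,3)] unfolding fst_conv snd_conv by blast
      obtain u' v' :: real where uv': "W a (p z) u'" "W (q z) b v'"
          "u' + v' + d (p z) (q z) \<le> d a b + 2 * T + 21 * R"
        using repairable_bridge[OF rep[OF zH] z(4,5)] by blast
      have "jump_walk E (F \<union> M) (p z) (q z) (d (p z) (q z))"
        using z(1) by (intro jump_walk_edge) (auto simp: M_def)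
      then have "jump_walk E (F \<union> M) s t (u + u' + d (p z) (q z) + v' + v)"
        using uv(1,2) uv'(1,2) by (meson WM jump_walk_trans)
      then show ?thesis by (rule jump_walk_mono) (use uv(3) uv'(3) in auto)
    qed
  qed
  have "jump_walk E (F \<union> M) s t (d s t + 4 * T + 53 * R)" if s: "s \<in> V" and st: "(s, t) \<in> E\<^sup>*" for s t
  proof -
    have cI: "ctr s \<in> I" using ctr[OF s] by simp
    have "0 \<le> R" using R_nonneg cI by simp
    \<comment> \<open>A start outside \<open>X\<close> first walks to its centre and on to the
      sphere at cost \<open>9 * R\<close>, which raises 44 to 53.\<close>
    have via: "W s y (9 * R)" if "y \<in> hop_ball E (ctr s) (\<rho> (ctr s))" for y
    proof -
      have "y \<in> hop_ball E (ctr s) (7 * r (ctr s))"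
        using that hop_ball_mono[of "\<rho> (ctr s)" "7 * r (ctr s)" E "ctr s"] radius[OF cI] by auto
      from jump_walk_trans[OF walk_ctr(2)[OF s] walk_star(1)[OF cI this]] show ?thesis by simp
    qed
    show ?thesis
    proof (cases "t \<in> hop_ball E (ctr s) (\<rho> (ctr s))")
      case True
      from WM[OF via[OF this]] show ?thesis
        by (rule jump_walk_mono) (use assms \<open>0 \<le> R\<close> in auto)
    next
      case False
      then obtain y where y: "y \<in> X" "y \<in> hop_sphere E (ctr s) (\<rho> (ctr s))"
          "(y, t) \<in> E\<^sup>*" "d s t = d s y + d y t"
        using exit_cluster[OF s st] by metis
      have "W s y (9 * R)" using via[of y] y(2) by (auto simp: hop_ball_def hop_sphere_def)
      from jump_walk_trans[OF WM[OF this] X[OF y(1,3)]] show ?thesis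
        by (rule jump_walk_mono) (use y(4) in auto)
    qed
  qed
  then show ?thesis using cardM MI by blast
qed

end

section \<open>Improving the exponent\<close>

text \<open>\<open>C\<close> and \<open>D\<close> are chosen before \<open>V\<close> and
  \<open>E\<close>, since the recursion applies one bound to all clusters at once. The
  \<open>itself\<close> argument fixes the vertex type, which induced subgraphs share.\<close>

definition emulator_exponent :: "'a itself \<Rightarrow> real \<Rightarrow> bool" where
  "emulator_exponent ty \<beta> \<longleftrightarrow> (\<exists>C>0. \<exists>D>0. \<forall>V (E :: ('a \<times> 'a) set).
    finite V \<longrightarrow> E \<subseteq> V \<times> V \<longrightarrow> sym E \<longrightarrow>
    (\<exists>F. F \<subseteq> V \<times> V \<and> F \<subseteq> E\<^sup>* \<and> real (card F) \<le> C * real (card V) \<and>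
      (\<forall>s\<in>V. \<forall>t. (s, t) \<in> E\<^sup>* \<longrightarrow>
        jump_walk E F s t (hop_dist E s t + D * card V powr \<beta>))))"

lemma emulator_exponentI:
  fixes C D :: real
  assumes "0 < C" "0 < D"
    and "\<And>V (E :: ('a \<times> 'a) set). finite V \<Longrightarrow> E \<subseteq> V \<times> V \<Longrightarrow> sym E \<Longrightarrow>
      \<exists>F. F \<subseteq> V \<times> V \<and> F \<subseteq> E\<^sup>* \<and> real (card F) \<le> C * real (card V) \<and>
        (\<forall>s\<in>V. \<forall>t. (s, t) \<in> E\<^sup>* \<longrightarrow> jump_walk E F s t (hop_dist E s t + D * card V powr \<beta>))"
  shows "emulator_exponent TYPE('a) \<beta>"
  unfolding emulator_exponent_def using assms by blast

text \<open>The vertices along a shortest path realise every distance from 0 up to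
  \<open>hop_dist E s t\<close>.\<close>

lemma hop_dist_less_card:
  assumes "finite V" "E \<subseteq> V \<times> V" "s \<in> V" "(s, t) \<in> E\<^sup>*"
  shows "hop_dist E s t < card V"
proof -
  have "{..hop_dist E s t} \<subseteq> hop_dist E s ` V"
  proof
    fix k assume "k \<in> {..hop_dist E s t}"
    then have k: "hop_dist E s t = k + (hop_dist E s t - k)" by simp
    have "(s, t) \<in> E ^^ (k + (hop_dist E s t - k))"
      using hop_dist_relpow[OF assms(4)] k by simp
    then obtain v where v: "(s, v) \<in> E ^^ k" "(v, t) \<in> E ^^ (hop_dist E s t - k)"
      by (auto simp: relpow_add)
    have sv: "(s, v) \<in> E\<^sup>*" and vt: "(v, t) \<in> E\<^sup>*" using v relpow_imp_rtrancl by metis+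
    have "hop_dist E s v = k"
      using hop_dist_triangle[OF sv vt] hop_dist_le[OF v(1)] hop_dist_le[OF v(2)] k by linarith
    moreover have "v \<in> V" using rtrancl_vertex[OF assms(2) sv assms(3)] .
    ultimately show "k \<in> hop_dist E s ` V" by blast
  qed
  then have "card {..hop_dist E s t} \<le> card V"
    using assms(1) by (meson card_image_le card_mono finite_imageI le_trans)
  then show ?thesis by simp
qed

text \<open>A star around one representative of each component; both legs of a detour are shorter
  than the number of vertices.\<close>

lemma emulator_exponent_1: "emulator_exponent TYPE('a) 1"
proof (rule emulator_exponentI[of 1 2])
  fix V and E :: "('a \<times> 'a) set"
  assume V: "finite V" and E: "E \<subseteq> V \<times> V" and sym: "sym E"
  \<comment> \<open>Vertices of one component satisfy the same predicate, so \<open>SOME\<close>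
    picks the same representative for all of them.\<close>
  define root where "root v = (SOME u. (v, u) \<in> E\<^sup>*)" for v
  have root: "(v, root v) \<in> E\<^sup>*" for v
    unfolding root_def by (rule someI[of _ v]) simp
  have root_eq: "root s = root t" if "(s, t) \<in> E\<^sup>*" for s t
  proof -
    have "(s, u) \<in> E\<^sup>* \<longleftrightarrow> (t, u) \<in> E\<^sup>*" for u
      using that rtrancl_symD[OF sym that] by (meson rtrancl_trans)
    then show ?thesis by (simp add: root_def)
  qed
  define F where "F = (\<lambda>v. (v, root v)) ` V"
  have FV: "F \<subseteq> V \<times> V" using rtrancl_vertex[OF E root] by (auto simp: F_def)
  have FE: "F \<subseteq> E\<^sup>*" using root by (auto simp: F_def)
  have "card F \<le> card V" using V by (simp add: F_def card_image_le)
  moreover have "jump_walk E F s t (hop_dist E s t + 2 * card V powr 1)"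
    if s: "s \<in> V" and st: "(s, t) \<in> E\<^sup>*" for s t
  proof -
    have t: "t \<in> V" using rtrancl_vertex[OF E st s] .
    have "hop_dist E s (root s) < card V" using hop_dist_less_card[OF V E s root] .
    then have 1: "jump_walk E F s (root s) (card V)"
      using s by (intro jump_walk_edge) (auto simp: F_def)
    have "hop_dist E (root s) t < card V"
      using hop_dist_less_card[OF V E t root] hop_dist_sym[OF sym] root_eq[OF st] by metis
    then have "jump_walk E F (root s) t (card V)"
      using t root_eq[OF st] by (intro jump_walk_edge) (auto simp: F_def)
    from jump_walk_trans[OF 1 this] show ?thesis
      by (rule jump_walk_mono) auto
  qed
  ultimately show "\<exists>F. F \<subseteq> V \<times> V \<and> F \<subseteq> E\<^sup>* \<and> real (card F) \<le> 1 * real (card V) \<and>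
      (\<forall>s\<in>V. \<forall>t. (s, t) \<in> E\<^sup>* \<longrightarrow> jump_walk E F s t (hop_dist E s t + 2 * card V powr 1))"
    using FV FE by auto
qed auto

section \<open>Clusters of linear total size\<close>

text \<open>The radius is multiplied by 8 as long as this enlarges the ball by more than a factor
  \<open>K\<close>. Balls have at most \<open>card V\<close> vertices, so
  \<open>K ^ j \<le> card V\<close> at the stopping index \<open>j\<close>.\<close>

lemma slow_growth_radius:
  fixes \<delta> :: real and R :: nat
  assumes V: "finite V" and E: "E \<subseteq> V \<times> V" and v: "v \<in> V" and \<delta>: "0 < \<delta>"
  shows "\<exists>r. R \<le> r \<and> real r \<le> R * card V powr \<delta> \<and>
    real (card (hop_ball E v (8 * r))) \<le> 8 powr (1 / \<delta>) * card (hop_ball E v r)"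
proof -
  \<comment> \<open>Since \<open>K powr \<delta>\<close> is 8, the bound
    \<open>K ^ j \<le> card V\<close> becomes
    \<open>8 ^ j \<le> card V powr \<delta>\<close>.\<close>
  define K :: real where "K = 8 powr (1 / \<delta>)"
  define b where "b j = real (card (hop_ball E v (8 ^ j * R)))" for j
  have K: "1 < K" using \<delta> by (simp add: K_def)
  have fin: "finite (hop_ball E v k)" for k using hop_ball_subset[OF E v] V finite_subset by metis
  have bV: "b j \<le> card V" for j
    using hop_ball_subset[OF E v] V by (simp add: b_def card_mono)
  have "1 \<le> card (hop_ball E v R)"
    using fin[of R] centre_in_hop_ball[of v E R] by (metis One_nat_def Suc_leI card_gt_0_iff empty_iff)
  then have b0: "1 \<le> b 0" by (simp add: b_def)
  have grow: "K ^ j \<le> b j" if "\<forall>i<j. K * b i < b (Suc i)" for j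
    using that
  proof (induction j)
    case (Suc j)
    then have "K * K ^ j \<le> K * b j" using K by (intro mult_left_mono) auto
    also have "\<dots> < b (Suc j)" using Suc by simp
    finally show ?case by simp
  qed (use b0 in simp)
  have "\<exists>j. b (Suc j) \<le> K * b j"
  proof (rule ccontr)
    assume "\<nexists>j. b (Suc j) \<le> K * b j"
    then have "K ^ j \<le> card V" for j using grow[of j] bV[of j] by (meson not_le order_trans)
    then show False using real_arch_pow[OF K, of "card V"] by (meson not_le)
  qed
  define j where "j = (LEAST j. b (Suc j) \<le> K * b j)"
  have j: "b (Suc j) \<le> K * b j" unfolding j_def using \<open>\<exists>j. _\<close> by (rule LeastI_ex)
  have "\<forall>i<j. K * b i < b (Suc i)" using not_less_Least by (fastforce simp: j_def)
  then have "K ^ j \<le> card V" using grow bV order_trans by blast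
  then have "(K ^ j) powr \<delta> \<le> card V powr \<delta>" using K \<delta> by (intro powr_mono2) auto
  moreover have "(K ^ j) powr \<delta> = 8 ^ j"
    using \<delta> by (simp add: K_def powr_realpow[symmetric] powr_powr)
  ultimately have "real (8 ^ j * R) \<le> R * card V powr \<delta>"
    using mult_left_mono[of "8 ^ j" "card V powr \<delta>" "real R"] by (simp add: mult.commute)
  moreover have "R \<le> 8 ^ j * R" by simp
  moreover have "real (card (hop_ball E v (8 * (8 ^ j * R)))) \<le> K * card (hop_ball E v (8 ^ j * R))"
    using j by (simp add: b_def mult.assoc)
  ultimately show ?thesis unfolding K_def by blast
qed

text \<open>The balls \<open>hop_ball E c (r c)\<close> are disjoint and their enlargements are larger only by a constant
  factor, which makes the total size linear. The price is the factor \<open>n\<^sup>\<delta>\<close> in the radius.\<close>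

lemma clustering:
  fixes \<delta> :: real and R :: nat
  assumes V: "finite V" and E: "E \<subseteq> V \<times> V" and sym: "sym E" and \<delta>: "0 < \<delta>"
  shows "\<exists>I r ctr. I \<subseteq> V \<and> (\<forall>c\<in>I. R \<le> r c \<and> real (r c) \<le> R * card V powr \<delta>) \<and>
    (\<forall>v\<in>V. ctr v \<in> I \<and> v \<in> hop_ball E (ctr v) (2 * r (ctr v))) \<and>
    (\<Sum>c\<in>I. real (card (hop_ball E c (7 * r c)))) \<le> 8 powr (1 / \<delta>) * card V"
proof -
  let ?K = "8 powr (1 / \<delta>)"
  have "\<exists>r. R \<le> r \<and> real r \<le> R * card V powr \<delta> \<and>
      real (card (hop_ball E v (8 * r))) \<le> ?K * card (hop_ball E v r)" if "v \<in> V" for v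
    using slow_growth_radius[OF V E that \<delta>] by simp
  then obtain r where r: "\<And>v. v \<in> V \<Longrightarrow> R \<le> r v \<and> real (r v) \<le> R * card V powr \<delta> \<and>
      real (card (hop_ball E v (8 * r v))) \<le> ?K * card (hop_ball E v (r v))"
    by metis
  define B where "B v = hop_ball E v (r v)" for v
  have "B v \<noteq> {}" for v unfolding B_def by (metis centre_in_hop_ball empty_iff)
  then obtain I where I: "I \<subseteq> V" "\<forall>u\<in>I. \<forall>v\<in>I. u \<noteq> v \<longrightarrow> B u \<inter> B v = {}"
      "\<forall>v\<in>V. \<exists>c\<in>I. r v \<le> r c \<and> B v \<inter> B c \<noteq> {}"
    using vitali_subfamily[OF V, of B r] by meson
  \<comment> \<open>The ball of \<open>v\<close> meets a selected ball of at least its radius, so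
    \<open>v\<close> is within \<open>r c + r v \<le> 2 * r c\<close> of \<open>c\<close>.\<close>
  have "\<exists>c. c \<in> I \<and> v \<in> hop_ball E c (2 * r c)" if v: "v \<in> V" for v
  proof -
    obtain c u where c: "c \<in> I" "r v \<le> r c" "u \<in> B v" "u \<in> B c" using I(3) v by blast
    have vu: "(v, u) \<in> E\<^sup>*" "hop_dist E v u \<le> r v" and cu: "(c, u) \<in> E\<^sup>*" "hop_dist E c u \<le> r c"
      using c by (auto simp: B_def hop_ball_def)
    have uv: "(u, v) \<in> E\<^sup>*" using rtrancl_symD[OF sym vu(1)] .
    then have "hop_dist E c v \<le> hop_dist E c u + hop_dist E u v"
      using cu by (intro hop_dist_triangle)
    then have "hop_dist E c v \<le> 2 * r c"
      using vu cu c(2) hop_dist_sym[OF sym, of u v] by linarith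
    then show ?thesis using c(1) rtrancl_trans[OF cu(1) uv] by (auto simp: hop_ball_def)
  qed
  then obtain ctr where ctr: "\<And>v. v \<in> V \<Longrightarrow> ctr v \<in> I \<and> v \<in> hop_ball E (ctr v) (2 * r (ctr v))"
    by metis
  have BV: "hop_ball E c k \<subseteq> V" if "c \<in> I" for c k using hop_ball_subset[OF E] I that by blast
  have finb: "finite (hop_ball E c k)" if "c \<in> I" for c k using finite_subset[OF BV[OF that] V] .
  have finI: "finite I" using finite_subset[OF I(1) V] .
  have "(\<Sum>c\<in>I. real (card (hop_ball E c (7 * r c)))) \<le> (\<Sum>c\<in>I. ?K * real (card (B c)))"
  proof (rule sum_mono)
    fix c assume c: "c \<in> I"
    have "card (hop_ball E c (7 * r c)) \<le> card (hop_ball E c (8 * r c))"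
      by (intro card_mono finb c hop_ball_mono) auto
    then show "real (card (hop_ball E c (7 * r c))) \<le> ?K * real (card (B c))"
      using r[of c] I(1) c by (auto simp: B_def)
  qed
  also have "\<dots> = ?K * real (card (\<Union>c\<in>I. B c))"
    using I(2) finI finb by (subst card_UN_disjoint) (auto simp: B_def sum_distrib_left)
  also have "\<dots> \<le> ?K * card V"
    using BV V by (intro mult_left_mono) (auto simp: B_def intro!: card_mono)
  finally show ?thesis using ctr r I(1) by (intro exI[of _ I] exI[of _ r] exI[of _ ctr]) auto
qed

section \<open>One round of the improvement\<close>

lemma hop_dist_antimono:
  assumes "(x, y) \<in> E'\<^sup>*" "E' \<subseteq> E"
  shows "hop_dist E x y \<le> hop_dist E' x y"
  by (rule hop_dist_le, rule relpow_subset[OF hop_dist_relpow[OF assms(1)] assms(2)])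

lemma real_card_UN_le:
  assumes "finite I" "\<And>i. i \<in> I \<Longrightarrow> real (card (A i)) \<le> f i"
  shows "real (card (\<Union>i\<in>I. A i)) \<le> sum f I"
proof -
  have "real (card (\<Union>i\<in>I. A i)) \<le> (\<Sum>i\<in>I. real (card (A i)))"
    using card_UN_le[OF assms(1), of A] by (metis of_nat_le_iff of_nat_sum)
  also have "\<dots> \<le> sum f I" using assms(2) by (rule sum_mono)
  finally show ?thesis .
qed

text \<open>Thin spheres have at most \<open>|cluster| / R\<close> vertices: \<open>O(n/R)\<close> in total, and at most \<open>R\<close> for a small
  cluster, so joining every sphere vertex to the sphere of its own small cluster costs \<open>O(n)\<close> edges.\<close>

lemma emulator_one_level:
  fixes \<beta> \<delta> C D :: real
  assumes \<beta>: "0 < \<beta>" "\<beta> \<le> 1" and \<delta>: "0 < \<delta>" and C: "0 < C" and D: "0 < D"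
    and rec: "\<And>V (E :: ('a \<times> 'a) set). finite V \<Longrightarrow> E \<subseteq> V \<times> V \<Longrightarrow> sym E \<Longrightarrow>
      \<exists>F. F \<subseteq> V \<times> V \<and> F \<subseteq> E\<^sup>* \<and> real (card F) \<le> C * real (card V) \<and>
        (\<forall>s\<in>V. \<forall>t. (s, t) \<in> E\<^sup>* \<longrightarrow> jump_walk E F s t (hop_dist E s t + D * card V powr \<beta>))"
    and V: "finite V" and E: "(E :: ('a \<times> 'a) set) \<subseteq> V \<times> V" and sym: "sym E" and ne: "V \<noteq> {}"
  defines "K \<equiv> 8 powr (1 / \<delta>)"
  shows "\<exists>F. F \<subseteq> V \<times> V \<and> F \<subseteq> E\<^sup>* \<and> real (card F) \<le> (K * (2 + C) + (D * K)\<^sup>2) * real (card V) \<and>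
    (\<forall>s\<in>V. \<forall>t. (s, t) \<in> E\<^sup>* \<longrightarrow>
      jump_walk E F s t (hop_dist E s t + 114 * card V powr (1 / (6 - 4 * \<beta>) + \<delta>)))"
proof -
  define n where "n = real (card V)"
  \<comment> \<open>With this exponent \<open>\<alpha> * (4 * \<beta> - 6) = -1\<close>, which makes
    the number of repair edges linear.\<close>
  define \<alpha> where "\<alpha> = 1 / (6 - 4 * \<beta>)"
  define R where "R = nat \<lceil>n powr \<alpha>\<rceil>"
  have "1 \<le> card V" using V ne by (simp add: Suc_leI card_gt_0_iff)
  then have n: "1 \<le> n" by (simp add: n_def)
  have \<alpha>: "0 < \<alpha>" using \<beta> by (simp add: \<alpha>_def)
  have n\<alpha>: "1 \<le> n powr \<alpha>" using n \<alpha> by (simp add: ge_one_powr_ge_zero)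
  have R: "n powr \<alpha> \<le> R" "real R \<le> 2 * n powr \<alpha>" "0 < R"
    using n\<alpha> unfolding R_def by linarith+
  have K: "0 < K" by (simp add: K_def)
  obtain I r ctr where I: "I \<subseteq> V" and "\<forall>c\<in>I. R \<le> r c \<and> real (r c) \<le> R * n powr \<delta>"
    and "\<forall>v\<in>V. ctr v \<in> I \<and> v \<in> hop_ball E (ctr v) (2 * r (ctr v))"
    and tot: "(\<Sum>c\<in>I. real (card (hop_ball E c (7 * r c)))) \<le> K * n"
    using clustering[OF V E sym \<delta>, of R, folded n_def K_def] by (elim exE conjE)
  then have r: "\<And>c. c \<in> I \<Longrightarrow> R \<le> r c \<and> real (r c) \<le> R * n powr \<delta>"
    and ctr: "\<And>v. v \<in> V \<Longrightarrow> ctr v \<in> I \<and> v \<in> hop_ball E (ctr v) (2 * r (ctr v))"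
    by blast+
  define A where "A c = hop_ball E c (7 * r c)" for c
  define S where "S c k = hop_sphere E c k" for c k
  have finI: "finite I" using finite_subset[OF I V] .
  have AV: "A c \<subseteq> V" if "c \<in> I" for c using hop_ball_subset[OF E] I that by (auto simp: A_def)
  have finA: "finite (A c)" if "c \<in> I" for c using finite_subset[OF AV[OF that] V] .
  have "\<exists>\<rho>. 6 * r c < \<rho> \<and> \<rho> \<le> 7 * r c \<and> r c * card (S c \<rho>) \<le> card (A c)" if "c \<in> I" for c
    unfolding S_def A_def
    by (rule thin_sphere_exists) (use finA[OF that] r[OF that] R(3) in \<open>auto simp: A_def\<close>)
  then obtain \<rho> where \<rho>: "\<And>c. c \<in> I \<Longrightarrow> 6 * r c < \<rho> c \<and> \<rho> c \<le> 7 * r c \<and>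
      r c * card (S c (\<rho> c)) \<le> card (A c)" by metis
  have SA: "S c (\<rho> c) \<subseteq> A c" if "c \<in> I" for c
    using \<rho>[OF that] by (auto simp: S_def A_def hop_ball_def hop_sphere_def)
  define X where "X = (\<Union>c\<in>I. S c (\<rho> c))"
  have XV: "X \<subseteq> V" using SA AV by (auto simp: X_def)
  have finX: "finite X" using finite_subset[OF XV V] .
  have ctrX: "ctr x \<in> I" "x \<in> A (ctr x)" "(ctr x, x) \<in> E\<^sup>*" if "x \<in> V" for x
    using ctr[OF that] hop_ball_mono[of "2 * r (ctr x)" "7 * r (ctr x)" E "ctr x"]
    by (auto simp: A_def hop_ball_def)
  define E' where "E' c = Restr E (A c)" for c
  have symE': "sym (E' c)" for c using sym by (auto simp: E'_def sym_def)
  have "\<exists>F. F \<subseteq> A c \<times> A c \<and> F \<subseteq> (E' c)\<^sup>* \<and> real (card F) \<le> C * real (card (A c)) \<and>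
      (\<forall>s\<in>A c. \<forall>t. (s, t) \<in> (E' c)\<^sup>* \<longrightarrow>
        jump_walk (E' c) F s t (hop_dist (E' c) s t + D * card (A c) powr \<beta>))"
    if "c \<in> I" for c
    by (rule rec[OF finA[OF that] _ symE']) (auto simp: E'_def)
  then obtain G where G: "\<And>c. c \<in> I \<Longrightarrow> G c \<subseteq> A c \<times> A c \<and> G c \<subseteq> (E' c)\<^sup>* \<and>
      real (card (G c)) \<le> C * real (card (A c)) \<and> (\<forall>s\<in>A c. \<forall>t. (s, t) \<in> (E' c)\<^sup>* \<longrightarrow>
        jump_walk (E' c) (G c) s t (hop_dist (E' c) s t + D * card (A c) powr \<beta>))" by metis
  define Y where "Y = {x \<in> X. card (A (ctr x)) \<le> R\<^sup>2}"
  \<comment> \<open>\<open>F1\<close> holds the stars, \<open>F2\<close> the exact hops out of small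
    clusters, \<open>F3\<close> the recursive emulators.\<close>
  define F1 where "F1 = (\<Union>c\<in>I. {c} \<times> A c)"
  define F2 where "F2 = (\<Union>x\<in>Y. {x} \<times> S (ctr x) (\<rho> (ctr x)))"
  define F3 where "F3 = (\<Union>c\<in>I. G c)"
  define F where "F = F1 \<union> F2 \<union> F3"
  define \<omega> where "\<omega> c = (if card (A c) \<le> R\<^sup>2 then 0 else D * card (A c) powr \<beta>)" for c

  have YX: "Y \<subseteq> X" by (auto simp: Y_def)
  have "F1 \<subseteq> V \<times> V" using I AV by (fastforce simp: F1_def)
  moreover have "F2 \<subseteq> V \<times> V" using YX XV ctrX(1) SA AV by (fastforce simp: F2_def)
  moreover have "F3 \<subseteq> V \<times> V" using G AV by (fastforce simp: F3_def)
  ultimately have FV: "F \<subseteq> V \<times> V" by (simp add: F_def)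
  have "F1 \<subseteq> E\<^sup>*" by (auto simp: F1_def A_def hop_ball_def)
  moreover have "F2 \<subseteq> E\<^sup>*"
  proof
    fix z assume "z \<in> F2"
    then obtain x y where z: "z = (x, y)" "x \<in> Y" "y \<in> S (ctr x) (\<rho> (ctr x))" by (auto simp: F2_def)
    then have "x \<in> V" using YX XV by auto
    then have "(x, ctr x) \<in> E\<^sup>*" using ctrX(3) rtrancl_symD[OF sym] by blast
    moreover have "(ctr x, y) \<in> E\<^sup>*" using z by (auto simp: S_def hop_sphere_def)
    ultimately show "z \<in> E\<^sup>*" using z(1) by auto
  qed
  moreover have "F3 \<subseteq> E\<^sup>*"
  proof
    fix z assume "z \<in> F3"
    then obtain c where "c \<in> I" "z \<in> G c" by (auto simp: F3_def)
    moreover have "(E' c)\<^sup>* \<subseteq> E\<^sup>*" for c by (rule rtrancl_mono) (auto simp: E'_def)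
    ultimately show "z \<in> E\<^sup>*" using G by blast
  qed
  ultimately have FE: "F \<subseteq> E\<^sup>*" by (simp add: F_def)

  interpret hub_system V E F I X r \<rho> ctr \<omega> "R * n powr \<delta>"
  proof
    show "6 * r c < \<rho> c \<and> \<rho> c \<le> 7 * r c \<and> real (r c) \<le> R * n powr \<delta>" if "c \<in> I" for c
      using \<rho>[OF that] r[OF that] by auto
    show "(c, y) \<in> F" if "c \<in> I" "y \<in> hop_ball E c (7 * r c)" for c y
      using that by (auto simp: F_def F1_def A_def)
    show "hop_sphere E c (\<rho> c) \<subseteq> X" if "c \<in> I" for c using that by (auto simp: X_def S_def)
    show "0 \<le> \<omega> c" for c using D by (simp add: \<omega>_def)
    fix x y assume x: "x \<in> X" and y: "y \<in> hop_sphere E (ctr x) (\<rho> (ctr x))"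
      and xy: "(x, y) \<in> (Restr E (hop_ball E (ctr x) (\<rho> (ctr x)))) ^^ hop_dist E x y"
    let ?c = "ctr x"
    have xV: "x \<in> V" using x XV by auto
    have c: "?c \<in> I" and xA: "x \<in> A ?c" using ctrX[OF xV] by auto
    show "jump_walk E F x y (hop_dist E x y + \<omega> ?c)"
    proof (cases "card (A ?c) \<le> R\<^sup>2")
      case True
      then have "(x, y) \<in> F" using x y by (auto simp: F_def F2_def Y_def S_def)
      then show ?thesis using True by (intro jump_walk_edge) (auto simp: \<omega>_def)
    next
      case False
      have "hop_ball E ?c (\<rho> ?c) \<subseteq> A ?c" unfolding A_def using \<rho>[OF c] by (intro hop_ball_mono) auto
      then have xy': "(x, y) \<in> (E' ?c) ^^ hop_dist E x y"
        using relpow_subset[OF xy, of "E' ?c"] by (auto simp: E'_def)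
      then have "(x, y) \<in> (E' ?c)\<^sup>*" by (rule relpow_imp_rtrancl)
      then have "jump_walk (E' ?c) (G ?c) x y (hop_dist (E' ?c) x y + D * card (A ?c) powr \<beta>)"
        using G[OF c] xA by blast
      then have "jump_walk E (G ?c) x y (hop_dist (E' ?c) x y + D * card (A ?c) powr \<beta>)"
      proof (rule jump_walk_change_dist)
        fix u v assume "(u, v) \<in> G ?c \<or> (v, u) \<in> G ?c"
        then have "(u, v) \<in> (E' ?c)\<^sup>*" using G[OF c] rtrancl_symD[OF symE'] by blast
        then show "hop_dist E u v \<le> hop_dist (E' ?c) u v"
          by (rule hop_dist_antimono) (auto simp: E'_def)
      qed
      then show ?thesis
        by (rule jump_walk_mono)
          (use False hop_dist_le[OF xy'] c in \<open>auto simp: \<omega>_def F_def F3_def\<close>)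
    qed
  qed (use V E sym I XV ctr in auto)

  \<comment> \<open>The threshold is \<open>R\<close> rather than the radius bound
    \<open>R * n powr \<delta>\<close>; the resulting error is still of the order of that
    bound.\<close>
  have "0 < real R" using R(3) by simp
  from repair_edges[OF this] obtain M where M: "M \<subseteq> I \<times> I" "M \<subseteq> E\<^sup>*"
      "real (card M) * (real R)\<^sup>2 \<le> (sum \<omega> I)\<^sup>2"
      "\<And>s t. s \<in> V \<Longrightarrow> (s, t) \<in> E\<^sup>* \<Longrightarrow>
        jump_walk E (F \<union> M) s t (hop_dist E s t + 4 * real R + 53 * (R * n powr \<delta>))"
    by blast

  have totA: "(\<Sum>c\<in>I. real (card (A c))) \<le> K * n" using tot by (simp add: A_def)
  have F1: "real (card F1) \<le> K * n"
    unfolding F1_def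
    by (rule order_trans[OF real_card_UN_le[OF finI] totA]) (simp add: card_cartesian_product_singleton)
  have RX: "real R * card X \<le> K * n"
  proof -
    have "real (card X) \<le> (\<Sum>c\<in>I. real (card (S c (\<rho> c))))"
      unfolding X_def by (rule real_card_UN_le[OF finI]) simp
    then have "real R * card X \<le> (\<Sum>c\<in>I. real R * card (S c (\<rho> c)))"
      unfolding sum_distrib_left[symmetric] by (intro mult_left_mono) auto
    also have "\<dots> \<le> (\<Sum>c\<in>I. real (card (A c)))"
    proof (rule sum_mono)
      fix c assume c: "c \<in> I"
      have "R * card (S c (\<rho> c)) \<le> r c * card (S c (\<rho> c))" using r[OF c] by simp
      also have "\<dots> \<le> card (A c)" using \<rho>[OF c] by simp
      finally show "real R * card (S c (\<rho> c)) \<le> card (A c)" by (metis of_nat_le_iff of_nat_mult)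
    qed
    finally show ?thesis using totA by simp
  qed
  have "real (card F2) \<le> (\<Sum>x\<in>Y. real R)"
    unfolding F2_def
  proof (rule real_card_UN_le)
    show "finite Y" using finX by (simp add: Y_def)
    fix x assume x: "x \<in> Y"
    then have c: "ctr x \<in> I" using ctrX(1) YX XV by blast
    have "R * card (S (ctr x) (\<rho> (ctr x))) \<le> r (ctr x) * card (S (ctr x) (\<rho> (ctr x)))"
      using r[OF c] by simp
    also have "\<dots> \<le> card (A (ctr x))" using \<rho>[OF c] by simp
    also have "\<dots> \<le> R * R" using x by (simp add: Y_def power2_eq_square)
    finally show "real (card ({x} \<times> S (ctr x) (\<rho> (ctr x)))) \<le> R"
      using R(3) by (simp add: card_cartesian_product_singleton)
  qed
  also have "\<dots> \<le> real R * card X"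
    using card_mono[OF finX YX] by (simp add: mult.commute mult_left_mono)
  finally have F2: "real (card F2) \<le> K * n" using RX by simp
  have "real (card F3) \<le> (\<Sum>c\<in>I. C * card (A c))"
    unfolding F3_def using G by (intro real_card_UN_le finI) blast
  also have "\<dots> \<le> C * (K * n)"
    using totA C by (simp add: sum_distrib_left[symmetric])
  finally have F3: "real (card F3) \<le> C * (K * n)" .

  \<comment> \<open>For a cluster of size \<open>a \<ge> R\<^sup>2\<close>,
    \<open>\<beta> \<le> 1\<close> gives \<open>a powr \<beta> \<le> q * a\<close>, so the hop
    errors are bounded by a multiple of the total cluster size.\<close>
  define q where "q = (real R)\<^sup>2 powr (\<beta> - 1)"
  have "sum \<omega> I \<le> (\<Sum>c\<in>I. D * q * card (A c))"
  proof (rule sum_mono)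
    fix c assume c: "c \<in> I"
    show "\<omega> c \<le> D * q * card (A c)"
    proof (cases "card (A c) \<le> R\<^sup>2")
      case True
      then show ?thesis using D by (simp add: \<omega>_def q_def)
    next
      case False
      define a where "a = real (card (A c))"
      have "real (R\<^sup>2) \<le> a" using False unfolding a_def by linarith
      then have a: "(real R)\<^sup>2 \<le> a" by simp
      have a0: "0 < a" using a R(3) by (meson less_le_trans of_nat_0_less_iff zero_less_power)
      have "a powr \<beta> = a powr (\<beta> - 1) * a" using a0 by (simp add: powr_diff)
      also have "a powr (\<beta> - 1) \<le> q"
        unfolding q_def using a R(3) \<beta> by (intro powr_mono2') auto
      finally have "a powr \<beta> \<le> q * a" using a0 by (simp add: mult_right_mono)
      then show ?thesis using False D by (simp add: \<omega>_def a_def mult.assoc)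
    qed
  qed
  also have "\<dots> \<le> D * q * (K * n)"
    unfolding sum_distrib_left[symmetric] using totA D by (intro mult_left_mono) (auto simp: q_def)
  finally have sum_le: "sum \<omega> I \<le> D * q * (K * n)" .
  have "0 \<le> sum \<omega> I" using D by (intro sum_nonneg) (simp add: \<omega>_def)
  then have "(sum \<omega> I)\<^sup>2 \<le> (D * q * (K * n))\<^sup>2" using sum_le by (rule power_mono[rotated])
  then have "real (card M) * (real R)\<^sup>2 \<le> (D * q * (K * n))\<^sup>2" using M(3) by simp
  then have "real (card M) \<le> (D * q * (K * n))\<^sup>2 / (real R)\<^sup>2"
    using R(3) by (simp add: pos_le_divide_eq)
  also have "\<dots> = (D * K)\<^sup>2 * n\<^sup>2 * (q\<^sup>2 / (real R)\<^sup>2)" by (simp add: power_mult_distrib)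
  also have "q\<^sup>2 / (real R)\<^sup>2 = real R powr (4 * \<beta> - 6)"
  proof -
    have R2: "(real R)\<^sup>2 = real R powr 2" using R(3) by simp
    have "q = real R powr (2 * (\<beta> - 1))" unfolding q_def R2 by (rule powr_powr)
    then have "q\<^sup>2 = real R powr (2 * (\<beta> - 1) + 2 * (\<beta> - 1))"
      by (simp only: power2_eq_square powr_add)
    also have "\<dots> / (real R)\<^sup>2 = real R powr (2 * (\<beta> - 1) + 2 * (\<beta> - 1) - 2)"
      unfolding R2 by (rule powr_diff[symmetric])
    finally show ?thesis by (simp add: algebra_simps)
  qed
  also have "real R powr (4 * \<beta> - 6) \<le> (n powr \<alpha>) powr (4 * \<beta> - 6)"
    using R(1) n\<alpha> \<beta> by (intro powr_mono2') auto
  also have "(n powr \<alpha>) powr (4 * \<beta> - 6) = n powr (-1)"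
  proof -
    have "\<alpha> * (4 * \<beta> - 6) = -1" using \<beta> by (simp add: \<alpha>_def field_simps)
    then show ?thesis by (simp add: powr_powr)
  qed
  also have "(D * K)\<^sup>2 * n\<^sup>2 * n powr (-1) = (D * K)\<^sup>2 * n"
    using n by (simp add: powr_minus power2_eq_square field_simps)
  finally have cM: "real (card M) \<le> (D * K)\<^sup>2 * n" by (simp add: mult_left_mono)

  show ?thesis
  proof (intro exI[of _ "F \<union> M"] conjI ballI allI impI)
    show "F \<union> M \<subseteq> V \<times> V" using FV M(1) I by auto
    show "F \<union> M \<subseteq> E\<^sup>*" using FE M(2) by auto
    have "card (F \<union> M) \<le> card F1 + card F2 + card F3 + card M"
      unfolding F_def by (meson card_Un_le add_le_mono le_trans order_refl)
    then have "real (card (F \<union> M)) \<le> real (card F1) + card F2 + card F3 + card M" by linarith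
    also have "\<dots> \<le> K * n + K * n + C * (K * n) + (D * K)\<^sup>2 * n" using F1 F2 F3 cM by linarith
    finally show "real (card (F \<union> M)) \<le> (K * (2 + C) + (D * K)\<^sup>2) * real (card V)"
      by (simp add: n_def algebra_simps)
    fix s t assume st: "s \<in> V" "(s, t) \<in> E\<^sup>*"
    have n\<delta>: "1 \<le> n powr \<delta>" using n \<delta> by (simp add: ge_one_powr_ge_zero)
    \<comment> \<open>Rounding \<open>n powr \<alpha>\<close> up costs at most a factor 2, which
      turns 57 into 114.\<close>
    have "4 * real R + 53 * (R * n powr \<delta>) \<le> 57 * (R * n powr \<delta>)"
      using mult_left_mono[OF n\<delta>, of "real R"] by simp
    also have "\<dots> \<le> 57 * (2 * n powr \<alpha> * n powr \<delta>)"
      using R(2) by (intro mult_left_mono mult_right_mono) auto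
    also have "\<dots> = 114 * n powr (\<alpha> + \<delta>)" by (simp add: powr_add)
    finally show "jump_walk E (F \<union> M) s t
        (hop_dist E s t + 114 * card V powr (1 / (6 - 4 * \<beta>) + \<delta>))"
      by (intro jump_walk_mono[OF M(4)[OF st]]) (simp_all add: n_def \<alpha>_def)
  qed
qed

section \<open>Iterating the improvement\<close>

text \<open>The old \<open>C\<close> and \<open>D\<close> enter only the new size constant; the new
  error constant is always 114.\<close>

lemma emulator_exponent_step:
  assumes "emulator_exponent TYPE('a) \<beta>" "0 < \<beta>" "\<beta> \<le> 1" "0 < \<delta>"
  shows "emulator_exponent TYPE('a) (1 / (6 - 4 * \<beta>) + \<delta>)"
proof -
  obtain C D where CD: "0 < C" "0 < D"
    and rec: "\<And>V (E :: ('a \<times> 'a) set). finite V \<Longrightarrow> E \<subseteq> V \<times> V \<Longrightarrow> sym E \<Longrightarrow>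
      \<exists>F. F \<subseteq> V \<times> V \<and> F \<subseteq> E\<^sup>* \<and> real (card F) \<le> C * real (card V) \<and>
        (\<forall>s\<in>V. \<forall>t. (s, t) \<in> E\<^sup>* \<longrightarrow> jump_walk E F s t (hop_dist E s t + D * card V powr \<beta>))"
    using assms(1) unfolding emulator_exponent_def by auto
  define K :: real where "K = 8 powr (1 / \<delta>)"
  show ?thesis
  proof (rule emulator_exponentI[of "K * (2 + C) + (D * K)\<^sup>2" 114])
    have "0 < K" by (simp add: K_def)
    then show "0 < K * (2 + C) + (D * K)\<^sup>2" using CD by (simp add: add_pos_nonneg)
    fix V and E :: "('a \<times> 'a) set"
    assume VE: "finite V" "E \<subseteq> V \<times> V" "sym E"
    show "\<exists>F. F \<subseteq> V \<times> V \<and> F \<subseteq> E\<^sup>* \<and> real (card F) \<le> (K * (2 + C) + (D * K)\<^sup>2) * real (card V) \<and>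
        (\<forall>s\<in>V. \<forall>t. (s, t) \<in> E\<^sup>* \<longrightarrow>
          jump_walk E F s t (hop_dist E s t + 114 * card V powr (1 / (6 - 4 * \<beta>) + \<delta>)))"
    proof (cases "V = {}")
      case False
      then show ?thesis
        using emulator_one_level[OF assms(2-4) CD rec VE] unfolding K_def by blast
    qed auto
  qed auto
qed

lemma emulator_exponent_mono:
  assumes "emulator_exponent TYPE('a) \<beta>" "\<beta> \<le> \<beta>'"
  shows "emulator_exponent TYPE('a) \<beta>'"
proof -
  obtain C D where CD: "0 < C" "0 < D"
    and rec: "\<And>V (E :: ('a \<times> 'a) set). finite V \<Longrightarrow> E \<subseteq> V \<times> V \<Longrightarrow> sym E \<Longrightarrow>
      \<exists>F. F \<subseteq> V \<times> V \<and> F \<subseteq> E\<^sup>* \<and> real (card F) \<le> C * real (card V) \<and>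
        (\<forall>s\<in>V. \<forall>t. (s, t) \<in> E\<^sup>* \<longrightarrow> jump_walk E F s t (hop_dist E s t + D * card V powr \<beta>))"
    using assms(1) unfolding emulator_exponent_def by auto
  show ?thesis
  proof (rule emulator_exponentI[OF CD])
    fix V and E :: "('a \<times> 'a) set"
    assume VE: "finite V" "E \<subseteq> V \<times> V" "sym E"
    obtain F where F: "F \<subseteq> V \<times> V" "F \<subseteq> E\<^sup>*" "real (card F) \<le> C * real (card V)"
      "\<forall>s\<in>V. \<forall>t. (s, t) \<in> E\<^sup>* \<longrightarrow> jump_walk E F s t (hop_dist E s t + D * card V powr \<beta>)"
      using rec[OF VE] by (elim exE conjE)
    have "jump_walk E F s t (hop_dist E s t + D * card V powr \<beta>')"
      if s: "s \<in> V" and st: "(s, t) \<in> E\<^sup>*" for s t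
    proof (rule jump_walk_mono)
      show "jump_walk E F s t (hop_dist E s t + D * card V powr \<beta>)" using F(4) s st by blast
      have "1 \<le> card V" using s VE(1) by (metis One_nat_def Suc_leI card_gt_0_iff empty_iff)
      then show "hop_dist E s t + D * card V powr \<beta> \<le> hop_dist E s t + D * card V powr \<beta>'"
        using CD assms(2) by (simp add: powr_mono)
    qed simp
    then show "\<exists>F. F \<subseteq> V \<times> V \<and> F \<subseteq> E\<^sup>* \<and> real (card F) \<le> C * real (card V) \<and>
        (\<forall>s\<in>V. \<forall>t. (s, t) \<in> E\<^sup>* \<longrightarrow> jump_walk E F s t (hop_dist E s t + D * card V powr \<beta>'))"
      using F(1-3) by (intro exI[of _ F]) auto
  qed
qed

text \<open>The exponent \<open>a = 1 / (3 + sqrt 5)\<close> is the smaller fixed point of \<open>\<beta> \<mapsto> 1 / (6 - 4 * \<beta>)\<close>.\<close>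

lemma exponent_contraction:
  fixes \<eta> :: real
  defines "a \<equiv> 1 / (3 + sqrt 5)"
  assumes "0 \<le> \<eta>" "a + \<eta> \<le> 1"
  shows "1 / (6 - 4 * (a + \<eta>)) \<le> a + 2 / 5 * \<eta>"
proof -
  have sq: "2 < sqrt (5::real)" by (rule real_less_rsqrt) simp
  have s5: "sqrt 5 * sqrt 5 = (5::real)" by simp
  have a: "a = (3 - sqrt 5) / 4"
    unfolding a_def using sq s5 by (simp add: field_simps)
  have fp: "a * (6 - 4 * a) = 1" unfolding a using s5 by (simp add: field_simps)
  have "a \<le> 1 / 5" unfolding a_def using sq by (simp add: field_simps)
  \<comment> \<open>Cross-multiplying and subtracting the fixed point equation leaves
    \<open>\<eta>\<close> times this bracket. It decreases in \<open>\<eta>\<close>, and at the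
    extreme \<open>\<eta> = 1 - a\<close> it equals \<open>4 / 5 - 4 * a\<close>, nonnegative by
    \<open>a \<le> 1 / 5\<close>.\<close>
  have "0 \<le> \<eta> * (12 / 5 - 28 / 5 * a - 8 / 5 * \<eta>)"
    using assms(2,3) \<open>a \<le> 1 / 5\<close> by (intro mult_nonneg_nonneg) auto
  also have "\<dots> = (a + 2 / 5 * \<eta>) * (6 - 4 * (a + \<eta>)) - a * (6 - 4 * a)"
    by (simp add: algebra_simps)
  finally have "1 \<le> (a + 2 / 5 * \<eta>) * (6 - 4 * (a + \<eta>))" using fp by simp
  then show ?thesis using assms(3) by (simp add: pos_divide_le_eq)
qed

text \<open>Starting from exponent 1, each round shrinks the excess over the fixed point to at most
  \<open>2 / 5\<close> of itself and adds \<open>\<delta>\<close>. Choosing \<open>\<delta>\<close>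
  as half the current excess leaves at most \<open>9 / 10\<close> of it.\<close>

lemma emulator_exponent_limit:
  assumes "0 < \<epsilon>"
  shows "emulator_exponent TYPE('a) (1 / (3 + sqrt 5) + \<epsilon>)"
proof -
  define a :: real where "a = 1 / (3 + sqrt 5)"
  have a: "0 < a" "a < 1" by (auto simp: a_def field_simps add_pos_nonneg)
  have "emulator_exponent TYPE('a) (a + (1 - a) * (9 / 10) ^ k)" for k
  proof (induction k)
    case 0
    then show ?case using emulator_exponent_1 by simp
  next
    case (Suc k)
    define \<eta> where "\<eta> = (1 - a) * (9 / 10) ^ k"
    have "0 < \<eta>" using a by (simp add: \<eta>_def)
    moreover have "\<eta> \<le> 1 - a"
      using a power_le_one[of "9 / 10 :: real" k] mult_left_le[of "(9 / 10) ^ k" "1 - a"]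
      by (simp add: \<eta>_def)
    ultimately have \<eta>: "0 < \<eta>" "a + \<eta> \<le> 1" by auto
    have step: "emulator_exponent TYPE('a) (1 / (6 - 4 * (a + \<eta>)) + \<eta> / 2)"
      using Suc a \<eta> by (intro emulator_exponent_step) (auto simp: \<eta>_def)
    have "1 / (6 - 4 * (a + \<eta>)) \<le> a + 2 / 5 * \<eta>"
      using exponent_contraction[of \<eta>] \<eta> by (simp add: a_def)
    moreover have "(1 - a) * (9 / 10) ^ Suc k = 9 / 10 * \<eta>" by (simp add: \<eta>_def)
    ultimately have "1 / (6 - 4 * (a + \<eta>)) + \<eta> / 2 \<le> a + (1 - a) * (9 / 10) ^ Suc k"
      by linarith
    with step show ?case by (rule emulator_exponent_mono)
  qed
  moreover obtain k where k: "(9 / 10 :: real) ^ k < \<epsilon>"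
    using real_arch_pow_inv[OF assms, of "9 / 10"] by auto
  have "(1 - a) * (9 / 10) ^ k \<le> (9 / 10) ^ k" using a by (intro mult_left_le_one_le) auto
  then have "(1 - a) * (9 / 10) ^ k \<le> \<epsilon>" using k by linarith
  ultimately show ?thesis unfolding a_def[symmetric]
    by (metis add_le_cancel_left emulator_exponent_mono)
qed

section \<open>Emulators as weighted graphs\<close>

context pair_wf_digraph
begin

section \<open>Walks in a digraph and powers of its arc relation\<close>

lemma awalk_imp_relpow: "awalk s p t \<Longrightarrow> (s, t) \<in> parcs G ^^ length p"
proof (induction p arbitrary: s)
  case (Cons e p)
  then have "(s, snd e) \<in> parcs G" "(snd e, t) \<in> parcs G ^^ length p"
    by (auto simp: awalk_Cons_iff)
  then show ?case unfolding list.size(4) by (simp add: relpow_Suc_I2 del: relpow.simps)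
qed (simp add: awalk_Nil_iff)

lemma relpow_imp_awalk:
  "(s, t) \<in> parcs G ^^ k \<Longrightarrow> s \<in> pverts G \<Longrightarrow> \<exists>p. awalk s p t \<and> length p = k"
proof (induction k arbitrary: s)
  case 0
  then show ?case by (auto simp: awalk_Nil_iff)
next
  case (Suc k)
  then obtain s' where s': "(s, s') \<in> parcs G" "(s', t) \<in> parcs G ^^ k" by (meson relpow_Suc_E2)
  then obtain p where "awalk s' p t" "length p = k" using Suc.IH in_arcsD2 by blast
  then show ?case using s'(1) by (intro exI[of _ "(s, s') # p"]) (auto simp: awalk_Cons_iff)
qed

lemma weighted_dist_le: "awalk s p t \<Longrightarrow> awalk_cost w p \<le> l \<Longrightarrow> weighted_dist G w s t \<le> ereal l"
  unfolding weighted_dist_def using min_cost_le_walk_cost[of s p t w] order_trans by fastforce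

lemma weighted_dist_ge: "(\<And>p. awalk s p t \<Longrightarrow> l \<le> ereal (awalk_cost w p)) \<Longrightarrow> l \<le> weighted_dist G w s t"
  unfolding weighted_dist_def \<mu>_def by (intro INF_greatest) auto

lemma graph_dist_connected:
  assumes "s \<in> pverts G" "(s, t) \<in> (parcs G)\<^sup>*"
  shows "graph_dist G s t = ereal (hop_dist (parcs G) s t)"
proof (rule antisym)
  have cost: "awalk_cost (\<lambda>_. 1) p = length p" for p by (induction p) auto
  obtain p where "awalk s p t" "length p = hop_dist (parcs G) s t"
    using relpow_imp_awalk[OF hop_dist_relpow[OF assms(2)] assms(1)] by blast
  then show "graph_dist G s t \<le> ereal (hop_dist (parcs G) s t)"
    unfolding graph_dist_def by (intro weighted_dist_le) (auto simp: cost)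
  show "ereal (hop_dist (parcs G) s t) \<le> graph_dist G s t"
    unfolding graph_dist_def
    by (rule weighted_dist_ge) (auto simp: cost intro: hop_dist_le awalk_imp_relpow)
qed

lemma graph_dist_disconnected:
  assumes "(s, t) \<notin> (parcs G)\<^sup>*"
  shows "graph_dist G s t = \<infinity>"
proof -
  have "\<not> awalk s p t" for p using awalk_imp_relpow relpow_imp_rtrancl assms by metis
  then have "\<infinity> \<le> graph_dist G s t" unfolding graph_dist_def by (intro weighted_dist_ge) auto
  then show ?thesis by simp
qed

end

text \<open>Weighting each edge by its distance in \<open>G\<close> turns the lower bound into the
  triangle inequality along walks of \<open>H\<close>. That \<open>F\<close> lies in the
  reachability relation keeps \<open>H\<close> from joining different components.\<close>

lemma additive_emulator_of_jumps:
  fixes G :: "'a pair_pre_digraph" and k :: real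
  assumes G: "pair_graph G" and FV: "F \<subseteq> pverts G \<times> pverts G" and FE: "F \<subseteq> (parcs G)\<^sup>*"
    and jumps: "\<And>s t. s \<in> pverts G \<Longrightarrow> (s, t) \<in> (parcs G)\<^sup>* \<Longrightarrow>
      jump_walk (parcs G) F s t (hop_dist (parcs G) s t + k)"
  shows "\<exists>H w. additive_emulator G H w k \<and> card (undirected_edges H) \<le> card F"
proof -
  interpret G: pair_graph G by fact
  let ?V = "pverts G" and ?E = "parcs G"
  have symE: "sym ?E" by (auto intro: symI G.arcs_symmetric)
  \<comment> \<open>Symmetrising and dropping loops yields a simple graph, and each undirected edge
    still comes from some pair in \<open>F\<close>.\<close>
  define H where "H = \<lparr>pverts = ?V, parcs = {(u, v). u \<noteq> v \<and> ((u, v) \<in> F \<or> (v, u) \<in> F)}\<rparr>"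
  define w where "w = (\<lambda>(u, v). real (hop_dist ?E u v))"
  have pv: "pverts H = ?V" by (simp add: H_def)
  have arc: "(u, v) \<in> parcs H \<longleftrightarrow> u \<noteq> v \<and> ((u, v) \<in> F \<or> (v, u) \<in> F)" for u v
    by (simp add: H_def)
  have arcsV: "parcs H \<subseteq> ?V \<times> ?V" using FV by (auto simp: H_def)
  have H: "pair_graph H"
  proof
    show "finite (pverts H)" using G.pair_finite_verts by (simp add: pv)
    show "finite (parcs H)"
      using arcsV G.pair_finite_verts by (meson finite_SigmaI finite_subset)
    show "symmetric (with_proj H)" by (auto simp: symmetric_def sym_def arc)
    show "fst e \<in> pverts H" "snd e \<in> pverts H" if "e \<in> parcs H" for e
      using arcsV that unfolding pv by auto
    show "fst e \<noteq> snd e" if "e \<in> parcs H" for e using that by (auto simp: H_def)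
  qed
  interpret H: pair_graph H by fact
  have arc_conn: "(u, v) \<in> ?E\<^sup>*" if "(u, v) \<in> parcs H" for u v
    using that FE rtrancl_symD[OF symE] by (auto simp: arc)
  have walk: "(s, t) \<in> ?E\<^sup>* \<and> real (hop_dist ?E s t) \<le> H.awalk_cost w p" if "H.awalk s p t" for s p t
    using that
  proof (induction p arbitrary: s)
    case (Cons e p)
    then have e: "(s, snd e) \<in> parcs H" "e = (s, snd e)" and p: "H.awalk (snd e) p t"
      by (auto simp: H.awalk_Cons_iff)
    have IH: "(snd e, t) \<in> ?E\<^sup>*" "real (hop_dist ?E (snd e) t) \<le> H.awalk_cost w p"
      using Cons.IH[OF p] by auto
    have "w e = real (hop_dist ?E s (snd e))" by (subst e(2)) (simp add: w_def)
    moreover have "hop_dist ?E s t \<le> hop_dist ?E s (snd e) + hop_dist ?E (snd e) t"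
      using arc_conn[OF e(1)] IH(1) by (rule hop_dist_triangle)
    ultimately show ?case using IH arc_conn[OF e(1)] by auto
  qed (auto simp: H.awalk_Nil_iff)
  have unwalk: "\<exists>p. H.awalk s p t \<and> H.awalk_cost w p \<le> l" if "jump_walk ?E F s t l" "s \<in> ?V" for s t l
    using that
  proof (induction rule: jump_walk.induct)
    case (stop l x)
    then show ?case by (intro exI[of _ "[]"]) (auto simp: H.awalk_Nil_iff pv)
  next
    case (jump x y l' l z)
    have "y \<in> ?V" using jump(1) FV by auto
    then obtain p where p: "H.awalk y p z" "H.awalk_cost w p \<le> l'" using jump by blast
    show ?case
    proof (cases "x = y")
      \<comment> \<open>A jump from a vertex to itself has no arc in \<open>H\<close>; leaving it
        out does not raise the cost.\<close>
      case True
      then show ?thesis using p jump(2) by auto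
    next
      case False
      then have "(x, y) \<in> parcs H" using jump(1) by (simp add: arc)
      then show ?thesis using p jump(2)
        by (intro exI[of _ "(x, y) # p"]) (auto simp: H.awalk_Cons_iff w_def)
    qed
  qed
  have "additive_emulator G H w k"
    unfolding additive_emulator_def
  proof (intro conjI ballI)
    show "edge_weighting H w"
      using hop_dist_sym[OF symE] by (auto simp: edge_weighting_def w_def)
    fix s t assume s: "s \<in> ?V" and t: "t \<in> ?V"
    show "graph_dist G s t \<le> weighted_dist H w s t"
      by (rule H.weighted_dist_ge) (use walk G.graph_dist_connected[OF s] in auto)
    show "weighted_dist H w s t \<le> graph_dist G s t + ereal k"
    proof (cases "(s, t) \<in> ?E\<^sup>*")
      case True
      then obtain p where "H.awalk s p t" "H.awalk_cost w p \<le> hop_dist ?E s t + k"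
        using unwalk[OF jumps] s by blast
      then show ?thesis using H.weighted_dist_le G.graph_dist_connected[OF s True] by fastforce
    next
      case False
      then show ?thesis by (simp add: G.graph_dist_disconnected)
    qed
  qed (use H pv in auto)
  moreover have "card (undirected_edges H) \<le> card F"
  proof -
    have finF: "finite F" using FV G.pair_finite_verts by (meson finite_SigmaI finite_subset)
    have "undirected_edges H \<subseteq> (\<lambda>(u, v). {u, v}) ` F"
      by (force simp: undirected_edges_def arc insert_commute)
    then show ?thesis using finF by (meson card_image_le card_mono finite_imageI le_trans)
  qed
  ultimately show ?thesis by blast
qed

theorem theorem1:
  fixes \<epsilon> :: real
  assumes "\<epsilon> > 0"
  shows "\<exists>C > (0::real). \<exists>D > (0::real). \<forall>G :: 'a pair_pre_digraph. pair_graph G \<longrightarrow>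
    (\<exists>H w k. additive_emulator G H w k \<and>
      real (card (undirected_edges H)) \<le> C * real (card (pverts G)) \<and>
      k \<le> D * real (card (pverts G)) powr (1 / (3 + sqrt 5) + \<epsilon>))"
proof -
  let ?\<beta> = "1 / (3 + sqrt 5) + \<epsilon>"
  obtain C D where CD: "0 < C" "0 < D"
    and emu: "\<And>V (E :: ('a \<times> 'a) set). finite V \<Longrightarrow> E \<subseteq> V \<times> V \<Longrightarrow> sym E \<Longrightarrow>
      \<exists>F. F \<subseteq> V \<times> V \<and> F \<subseteq> E\<^sup>* \<and> real (card F) \<le> C * real (card V) \<and>
        (\<forall>s\<in>V. \<forall>t. (s, t) \<in> E\<^sup>* \<longrightarrow> jump_walk E F s t (hop_dist E s t + D * card V powr ?\<beta>))"
    using emulator_exponent_limit[OF assms, where 'a = 'a] unfolding emulator_exponent_def by auto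
  have "\<exists>H w k. additive_emulator G H w k \<and>
      real (card (undirected_edges H)) \<le> C * real (card (pverts G)) \<and>
      k \<le> D * real (card (pverts G)) powr ?\<beta>"
    if G: "pair_graph G" for G :: "'a pair_pre_digraph"
  proof -
    interpret G: pair_graph G by fact
    have sub: "parcs G \<subseteq> pverts G \<times> pverts G" using G.wellformed' by auto
    have sym: "sym (parcs G)" by (auto intro: symI G.arcs_symmetric)
    obtain F where F: "F \<subseteq> pverts G \<times> pverts G" "F \<subseteq> (parcs G)\<^sup>*"
        "real (card F) \<le> C * real (card (pverts G))"
        "\<forall>s\<in>pverts G. \<forall>t. (s, t) \<in> (parcs G)\<^sup>* \<longrightarrow>
          jump_walk (parcs G) F s t (hop_dist (parcs G) s t + D * card (pverts G) powr ?\<beta>)"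
      using emu[OF G.pair_finite_verts sub sym] by (elim exE conjE)
    obtain H w where "additive_emulator G H w (D * card (pverts G) powr ?\<beta>)"
        "card (undirected_edges H) \<le> card F"
      using additive_emulator_of_jumps[OF G F(1,2)] F(4) by blast
    then show ?thesis using F(3) by (meson of_nat_mono order_refl order_trans)
  qed
  then show ?thesis using CD by blast
qed

end
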